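(* Let $E$ and $F$ be graded Fréchet spaces which are of almost universal disposition for finite-dimensional graded Fréchet spaces. Let $\varepsilon>0$, let $X\subseteq E$ be a finite-dimensional subspace and let $f\colon X\to F$ be an $\varepsilon$-isometric embedding. Then there exists a bijective isometry $h\colon E\to F$ satisfying $$\|h(x)-f(x)\|_i<4\varepsilon\|x\|_i$$ for all $i\in\mathbb{N}$ and all $x\in X$.
   Context: A Fréchet space is a complete metrizable locally convex space; it is always considered with a fixed sequence of semi-norms $\{\|\cdot\|_i\}_{i\in\mathbb{N}}$ generating its topology. It is called graded if $\|\cdot\|_1\le\|\cdot\|_2\le\cdots$. Subspaces carry the restricted semi-norms; writing $X\subseteq Y$ for Fréchet spaces means that $X$ is a linear subspace of $Y$ whose $i$-th semi-norm is the restriction of the $i$-th semi-norm of $Y$, for every $i$. All mappings considered are linear. An embedding $f\colon X\to Y$ between Fréchet spaces is an $\varepsilon$-isometric embedding if $(1+\varepsilon)^{-1}\|x\|_i\le\|f(x)\|_i\le(1+\varepsilon)\|x\|_i$ for all $i\in\mathbb{N}$ and $x\in X$; it is an isometric embedding if $\|f(x)\|_i=\|x\|_i$ for all $i\in\mathbb{N}$ and $x\in X$. A bijective isometry is a bijective isometric embedding. A graded Fréchet space $E$ is of almost universal disposition for finite-dimensional graded Fréchet spaces if for every $\varepsilon>0$, for all finite-dimensional graded Fréchet spaces $X\subseteq Y$ and every isometric embedding $f_0\colon X\to E$ there exists an $\varepsilon$-isometric embedding $f\colon Y\to E$ with $f\restriction X=f_0$.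
   Formalization: E and F are additionally assumed separable (the claim fails for a separable E and a non-separable F), and the strict inequality is asserted only where the i-th semi-norm of x is non-zero, with ≤ elsewhere, since it reads 0 < 0 at x = 0. *)

theory Defs
  imports "HOL-Analysis.Analysis" "HOL-Analysis.Finite_Function_Topology"
begin

text \<open>
  A space is a linear subspace \<open>S\<close> of a type of class \<open>real_vector\<close> together with a family
  \<open>p :: nat \<Rightarrow> 'a \<Rightarrow> real\<close> whose members matter only on \<open>S\<close>.  Consequently ``\<open>X \<subseteq> Y\<close> for
  Frechet spaces'' reads \<open>subspace X \<and> X \<subseteq> Y\<close> with one and the same family of semi-norms.
  Semi-norms are indexed from \<open>0\<close>.
\<close>

definition seminorm_on :: "'a::real_vector set \<Rightarrow> ('a \<Rightarrow> real) \<Rightarrow> bool" where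
  "seminorm_on S p \<longleftrightarrow>
     (\<forall>x\<in>S. 0 \<le> p x) \<and>
     (\<forall>c. \<forall>x\<in>S. p (c *\<^sub>R x) = \<bar>c\<bar> * p x) \<and>
     (\<forall>x\<in>S. \<forall>y\<in>S. p (x + y) \<le> p x + p y)"

definition seminorm_topology ::
    "'a::real_vector set \<Rightarrow> (nat \<Rightarrow> 'a \<Rightarrow> real) \<Rightarrow> 'a topology" where
  "seminorm_topology S p =
     topology_generated_by {{y \<in> S. p i (y - x) < e} | i x e. x \<in> S \<and> 0 < e}"

definition frechet_space :: "'a::real_vector set \<Rightarrow> (nat \<Rightarrow> 'a \<Rightarrow> real) \<Rightarrow> bool" where
  "frechet_space S p \<longleftrightarrow>
     subspace S \<and>
     (\<forall>i. seminorm_on S (p i)) \<and>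
     metrizable_space (seminorm_topology S p) \<and>
     (\<forall>\<sigma> :: nat \<Rightarrow> 'a.
        range \<sigma> \<subseteq> S \<and>
        (\<forall>i. \<forall>e>0. \<exists>N. \<forall>m\<ge>N. \<forall>n\<ge>N. p i (\<sigma> m - \<sigma> n) < e) \<longrightarrow>
        (\<exists>l. limitin (seminorm_topology S p) \<sigma> l sequentially))"

definition graded_frechet_space :: "'a::real_vector set \<Rightarrow> (nat \<Rightarrow> 'a \<Rightarrow> real) \<Rightarrow> bool" where
  "graded_frechet_space S p \<longleftrightarrow>
     frechet_space S p \<and> (\<forall>i. \<forall>x\<in>S. p i x \<le> p (Suc i) x)"

definition finite_dimensional :: "'a::real_vector set \<Rightarrow> bool" where
  "finite_dimensional S \<longleftrightarrow> subspace S \<and> (\<exists>B. finite B \<and> S = span B)"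

definition linear_on :: "'a::real_vector set \<Rightarrow> ('a \<Rightarrow> 'b::real_vector) \<Rightarrow> bool" where
  "linear_on S f \<longleftrightarrow>
     (\<forall>x\<in>S. \<forall>y\<in>S. f (x + y) = f x + f y) \<and> (\<forall>c. \<forall>x\<in>S. f (c *\<^sub>R x) = c *\<^sub>R f x)"

text \<open>
  Between Frechet spaces the two-sided bounds below make \<open>f\<close> injective on \<open>X\<close> and a homeomorphism
  onto its image, so that being an embedding is not a separate condition.
\<close>

definition eps_isometric_embedding ::
    "real \<Rightarrow> 'a::real_vector set \<Rightarrow> (nat \<Rightarrow> 'a \<Rightarrow> real) \<Rightarrow>
     'b::real_vector set \<Rightarrow> (nat \<Rightarrow> 'b \<Rightarrow> real) \<Rightarrow> ('a \<Rightarrow> 'b) \<Rightarrow> bool" where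
  "eps_isometric_embedding \<epsilon> X p Y q f \<longleftrightarrow>
     linear_on X f \<and> f ` X \<subseteq> Y \<and>
     (\<forall>i. \<forall>x\<in>X. inverse (1 + \<epsilon>) * p i x \<le> q i (f x) \<and> q i (f x) \<le> (1 + \<epsilon>) * p i x)"

definition isometric_embedding ::
    "'a::real_vector set \<Rightarrow> (nat \<Rightarrow> 'a \<Rightarrow> real) \<Rightarrow>
     'b::real_vector set \<Rightarrow> (nat \<Rightarrow> 'b \<Rightarrow> real) \<Rightarrow> ('a \<Rightarrow> 'b) \<Rightarrow> bool" where
  "isometric_embedding X p Y q f \<longleftrightarrow>
     linear_on X f \<and> f ` X \<subseteq> Y \<and> (\<forall>i. \<forall>x\<in>X. q i (f x) = p i x)"

definition bijective_isometry ::
    "'a::real_vector set \<Rightarrow> (nat \<Rightarrow> 'a \<Rightarrow> real) \<Rightarrow>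
     'b::real_vector set \<Rightarrow> (nat \<Rightarrow> 'b \<Rightarrow> real) \<Rightarrow> ('a \<Rightarrow> 'b) \<Rightarrow> bool" where
  "bijective_isometry X p Y q f \<longleftrightarrow> isometric_embedding X p Y q f \<and> bij_betw f X Y"

text \<open>
  A definition cannot quantify over types, so \<open>Y\<close> ranges over the finite-dimensional subspaces of
  the space \<open>(nat, real) poly_mapping\<close> of finitely supported sequences, with arbitrary semi-norms.  Every
  finite-dimensional real vector space has an isomorphic copy there;
  \<open>almost_universal_disposition_any_type\<close> below transfers the property to \<open>Y\<close> in any type.
\<close>

definition almost_universal_disposition ::
    "'a::real_vector set \<Rightarrow> (nat \<Rightarrow> 'a \<Rightarrow> real) \<Rightarrow> bool" where
  "almost_universal_disposition E p \<longleftrightarrow>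
     (\<forall>\<epsilon>>0. \<forall>(X :: ((nat, real) poly_mapping) set) Y r f\<^sub>0.
        graded_frechet_space Y r \<and> finite_dimensional Y \<and> subspace X \<and> X \<subseteq> Y \<and>
        isometric_embedding X r E p f\<^sub>0 \<longrightarrow>
        (\<exists>f. eps_isometric_embedding \<epsilon> Y r E p f \<and> (\<forall>x\<in>X. f x = f\<^sub>0 x)))"


subsection \<open>Independence of the ambient type\<close>

lemma linear_embedding_finitely_supported:
  fixes Y :: "'c::real_vector set"
  assumes "finite_dimensional Y"
  obtains \<phi> :: "'c \<Rightarrow> (nat, real) poly_mapping" and \<psi>
  where "linear \<phi>" "linear \<psi>" "\<And>y. y \<in> Y \<Longrightarrow> \<psi> (\<phi> y) = y"
proof -
  obtain B0 where B0: "finite B0" "Y = span B0"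
    using assms unfolding finite_dimensional_def by blast
  obtain B where B: "B \<subseteq> B0" "independent B" "B0 \<subseteq> span B"
    using maximal_independent_subset[of B0] by blast
  have Y: "Y = span B"
    using B B0 by (metis span_mono span_span subset_antisym)
  have "finite B" using B B0 finite_subset by blast
  then obtain n :: "'c \<Rightarrow> nat" where n: "inj_on n B"
    using finite_imp_inj_to_nat_seg by blast
  obtain \<phi> :: "'c \<Rightarrow> (nat, real) poly_mapping"
    where \<phi>: "linear \<phi>" "\<And>b. b \<in> B \<Longrightarrow> \<phi> b = Poly_Mapping.single (n b) 1"
    using linear_independent_extend[OF B(2), of "\<lambda>b. Poly_Mapping.single (n b) 1"] by blast
  have lookup_scale: "Poly_Mapping.lookup (c *\<^sub>R z) k = c * Poly_Mapping.lookup z k"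
    for c :: real and z :: "(nat, real) poly_mapping" and k
    by (simp add: scaleR_poly_mapping_def)
  have "y = 0" if "y \<in> Y" "\<phi> y = 0" for y
  proof -
    obtain u where u: "y = (\<Sum>b\<in>B. u b *\<^sub>R b)"
      using \<open>y \<in> Y\<close> span_finite[OF \<open>finite B\<close>] unfolding Y by auto
    have "u a = 0" if "a \<in> B" for a
    proof -
      have "0 = Poly_Mapping.lookup (\<phi> y) (n a)"
        using \<open>\<phi> y = 0\<close> by simp
      also have "\<phi> y = (\<Sum>b\<in>B. u b *\<^sub>R Poly_Mapping.single (n b) 1)"
        using \<phi> by (simp add: u linear_sum linear_scale)
      also have "Poly_Mapping.lookup \<dots> (n a) = (\<Sum>b\<in>B. u b * (if n b = n a then 1 else 0))"
        by (simp add: lookup_sum lookup_scale lookup_single when_def)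
      also have "\<dots> = (\<Sum>b\<in>B. if b = a then u b else 0)"
        using n \<open>a \<in> B\<close> by (intro sum.cong) (auto dest: inj_onD)
      also have "\<dots> = u a"
        using \<open>finite B\<close> \<open>a \<in> B\<close> by simp
      finally show ?thesis by simp
    qed
    then show "y = 0" by (simp add: u)
  qed
  then have "inj_on \<phi> (span B)"
    using linear_inj_on_iff_eq_0[OF \<phi>(1) subspace_span] Y by blast
  then obtain \<psi> where "linear \<psi>" "\<forall>y\<in>span B. \<psi> (\<phi> y) = y"
    using linear_exists_left_inverse_on[OF \<phi>(1) subspace_span] by blast
  then show thesis
    using that \<phi>(1) Y by blast
qed

lemma topspace_seminorm_topology [simp]: "topspace (seminorm_topology S p) = S"
proof -
  have "x \<in> {y \<in> S. p 0 (y - x) < \<bar>p 0 0\<bar> + 1}" if "x \<in> S" for x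
    using that by simp
  moreover have "0 < \<bar>p 0 0\<bar> + 1" by simp
  ultimately show ?thesis
    unfolding seminorm_topology_def topology_generated_by_topspace by blast
qed

lemma continuous_map_seminorm_topology_isometry:
  assumes "linear f" "subspace S" "f ` S = T"
    and iso: "\<And>i x. x \<in> S \<Longrightarrow> q i (f x) = p i x"
  shows "continuous_map (seminorm_topology S p) (seminorm_topology T q) f"
proof -
  show ?thesis
    unfolding seminorm_topology_def[of T q] continuous_on_generated_topo_iff
  proof (intro conjI allI impI)
    fix U assume "U \<in> {{y \<in> T. q i (y - x) < e} |i x e. x \<in> T \<and> 0 < e}"
    then obtain i z e where U: "U = {y \<in> T. q i (y - f z) < e}" "z \<in> S" "0 < e"
      using assms(3) by blast
    have fT: "f y \<in> T" if "y \<in> S" for y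
      using that assms(3) by blast
    have diff: "q i (f y - f z) = p i (y - z)" if "y \<in> S" for y
      using iso[of "y - z" i] that \<open>z \<in> S\<close> assms(1,2) by (simp add: linear_diff subspace_diff)
    have "f -` U \<inter> topspace (seminorm_topology S p) = {y \<in> S. p i (y - z) < e}"
      unfolding U(1) by (auto simp: fT diff)
    moreover have "openin (seminorm_topology S p) {y \<in> S. p i (y - z) < e}"
      unfolding seminorm_topology_def using U by (intro topology_generated_by_Basis) blast
    ultimately show "openin (seminorm_topology S p) (f -` U \<inter> topspace (seminorm_topology S p))"
      by simp
  next
    have "\<Union> {{y \<in> T. q i (y - x) < e} |i x e. x \<in> T \<and> 0 < e} = T"
      using topspace_seminorm_topology[of T q] unfolding seminorm_topology_def topology_generated_by_topspace .
    then show "f ` topspace (seminorm_topology S p) \<subseteq>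
             \<Union> {{y \<in> T. q i (y - x) < e} |i x e. x \<in> T \<and> 0 < e}"
      using assms(3) by simp
  qed
qed

lemma almost_universal_disposition_any_type:
  fixes Y :: "'c::real_vector set"
  assumes E: "almost_universal_disposition E p" and "0 < \<epsilon>"
    and Y: "graded_frechet_space Y r" "finite_dimensional Y"
    and X: "subspace X" "X \<subseteq> Y" and f0: "isometric_embedding X r E p f\<^sub>0"
  shows "\<exists>f. eps_isometric_embedding \<epsilon> Y r E p f \<and> (\<forall>x\<in>X. f x = f\<^sub>0 x)"
proof -
  obtain \<phi> :: "'c \<Rightarrow> (nat, real) poly_mapping" and \<psi>
    where lin: "linear \<phi>" "linear \<psi>" and inv: "\<And>y. y \<in> Y \<Longrightarrow> \<psi> (\<phi> y) = y"
    using linear_embedding_finitely_supported[OF Y(2)] by blast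
  define r' where "r' i z = r i (\<psi> z)" for i z
  let ?Y = "\<phi> ` Y"
  have sub: "subspace Y" and sn: "\<And>i. seminorm_on Y (r i)"
    and met: "metrizable_space (seminorm_topology Y r)"
    and compl: "\<And>\<sigma>. range \<sigma> \<subseteq> Y \<Longrightarrow>
        \<forall>i. \<forall>e>0. \<exists>N. \<forall>m\<ge>N. \<forall>n\<ge>N. r i (\<sigma> m - \<sigma> n) < e \<Longrightarrow>
        \<exists>l. limitin (seminorm_topology Y r) \<sigma> l sequentially"
    and mono: "\<And>i x. x \<in> Y \<Longrightarrow> r i x \<le> r (Suc i) x"
    using Y(1) unfolding graded_frechet_space_def frechet_space_def by blast+
  have sub': "subspace ?Y" using lin sub by (simp add: linear_subspace_image)
  have inv': "\<psi> z \<in> Y" "\<phi> (\<psi> z) = z" if "z \<in> ?Y" for z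
    using that inv by auto
  have img: "\<psi> ` ?Y = Y" using inv by force
  have c1: "continuous_map (seminorm_topology Y r) (seminorm_topology ?Y r') \<phi>"
    by (rule continuous_map_seminorm_topology_isometry) (use lin sub inv in \<open>auto simp: r'_def\<close>)
  have c2: "continuous_map (seminorm_topology ?Y r') (seminorm_topology Y r) \<psi>"
    by (rule continuous_map_seminorm_topology_isometry)
       (use lin sub' img in \<open>auto simp: r'_def\<close>)
  have "homeomorphic_maps (seminorm_topology Y r) (seminorm_topology ?Y r') \<phi> \<psi>"
    unfolding homeomorphic_maps_def using c1 c2 inv inv'(2) by simp
  then have met': "metrizable_space (seminorm_topology ?Y r')"
    using met homeomorphic_metrizable_space homeomorphic_space_def by blast
  have "frechet_space ?Y r'"
    unfolding frechet_space_def
  proof (intro conjI allI impI)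
    show "seminorm_on ?Y (r' i)" for i
      using sn[of i] inv' lin unfolding seminorm_on_def r'_def
      by (simp add: linear_add linear_scale inv)
    fix \<sigma> :: "nat \<Rightarrow> (nat, real) poly_mapping"
    assume \<sigma>: "range \<sigma> \<subseteq> ?Y \<and>
      (\<forall>i. \<forall>e>0. \<exists>N. \<forall>m\<ge>N. \<forall>n\<ge>N. r' i (\<sigma> m - \<sigma> n) < e)"
    then have \<sigma>k: "\<sigma> k \<in> ?Y" for k by blast
    have "\<exists>l. limitin (seminorm_topology Y r) (\<psi> \<circ> \<sigma>) l sequentially"
    proof (rule compl)
      show "range (\<psi> \<circ> \<sigma>) \<subseteq> Y"
        using inv'(1)[OF \<sigma>k] by auto
      show "\<forall>i. \<forall>e>0. \<exists>N. \<forall>m\<ge>N. \<forall>n\<ge>N. r i ((\<psi> \<circ> \<sigma>) m - (\<psi> \<circ> \<sigma>) n) < e"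
        using \<sigma> lin by (simp add: r'_def linear_diff)
    qed
    then obtain l where "limitin (seminorm_topology Y r) (\<psi> \<circ> \<sigma>) l sequentially" by blast
    then have "limitin (seminorm_topology ?Y r') (\<phi> \<circ> (\<psi> \<circ> \<sigma>)) (\<phi> l) sequentially"
      by (rule continuous_map_limit[OF c1])
    moreover have "\<phi> \<circ> (\<psi> \<circ> \<sigma>) = \<sigma>"
      using \<sigma>k inv'(2) by (simp add: fun_eq_iff)
    ultimately show "\<exists>l. limitin (seminorm_topology ?Y r') \<sigma> l sequentially" by metis
  qed (use sub' met' in auto)
  then have g: "graded_frechet_space ?Y r'"
    unfolding graded_frechet_space_def using mono inv'(1) by (simp add: r'_def inv)
  have "finite_dimensional ?Y"
    using Y(2) sub' lin unfolding finite_dimensional_def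
    by (metis finite_imageI linear_span_image)
  moreover have "subspace (\<phi> ` X)" "\<phi> ` X \<subseteq> ?Y"
    using lin X by (auto simp: linear_subspace_image)
  moreover have "isometric_embedding (\<phi> ` X) r' E p (f\<^sub>0 \<circ> \<psi>)"
  proof -
    have invX: "\<psi> (\<phi> x) = x" if "x \<in> X" for x
      using inv X(2) that by blast
    then show ?thesis
      using f0 lin unfolding isometric_embedding_def linear_on_def r'_def
      by (simp add: linear_add linear_scale image_subset_iff)
  qed
  ultimately obtain f where f: "eps_isometric_embedding \<epsilon> ?Y r' E p f"
    "\<forall>x\<in>\<phi> ` X. f x = (f\<^sub>0 \<circ> \<psi>) x"
    using E[unfolded almost_universal_disposition_def, rule_format, OF \<open>0 < \<epsilon>\<close>,
        of ?Y r' "\<phi> ` X" "f\<^sub>0 \<circ> \<psi>"] g by metis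
  have "eps_isometric_embedding \<epsilon> Y r E p (f \<circ> \<phi>)"
    using f(1) inv lin unfolding eps_isometric_embedding_def linear_on_def r'_def
    by (simp add: linear_add linear_scale image_subset_iff)
  moreover have "\<forall>x\<in>X. (f \<circ> \<phi>) x = f\<^sub>0 x"
    using f(2) inv X(2) by (simp add: subset_iff)
  ultimately show ?thesis by blast
qed

end

theory Submission
  imports Defs
begin

text \<open>
  The proof is a back-and-forth argument along a chain of almost isometries between finite-dimensional
  subspaces, in the form used for the Gurarij space.

  The basic move improves an almost isometric embedding \<open>f : X \<rightarrow> F\<close> of distortion \<open>e\<close>. Let
  \<open>Y \<supseteq> f(X)\<close> be finite-dimensional. The graph of \<open>f\<close> can be made short without disturbing \<open>X\<close> and \<open>Y\<close>:
  on \<open>X \<times> Y\<close> there are graded semi-norms that restrict to the given ones on both factors and for which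
  \<open>(x, - f x)\<close> has size at most \<open>e \<parallel>x\<parallel>\<close> (lemmas \<open>amalgam_fst\<close>, \<open>amalgam_snd\<close>, \<open>amalgam_graph\<close>). Almost
  universal disposition of \<open>E\<close> extends the inclusion \<open>X \<rightarrow> E\<close> to this amalgam, with distortion \<open>d\<close> as
  small as desired. On \<open>Y\<close> the extension is an embedding \<open>g : Y \<rightarrow> E\<close> of distortion \<open>d\<close> with
  \<open>\<parallel>g (f x) - x\<parallel> \<le> (1 + d) e \<parallel>x\<parallel>\<close> (lemma \<open>almost_left_inverse\<close>). Thus \<open>f\<close> is almost inverted, the new
  distortion is unrelated to the old one, and the price is an error governed by the old one.

  Two such moves, one in each direction, replace \<open>f : X \<rightarrow> F\<close> by some \<open>f' : X' \<rightarrow> F\<close> of distortion \<open>d\<close>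
  with \<open>\<parallel>f' x - f x\<parallel>\<close> bounded by about \<open>e \<parallel>x\<parallel>\<close>; on the way \<open>X'\<close> is made to contain prescribed vectors
  of \<open>E\<close>, and the image of \<open>f'\<close> to come close to prescribed vectors of \<open>F\<close> (lemma
  \<open>back_and_forth_step\<close>). Iterating with distortions \<open>e\<^sub>n = \<epsilon> \<rho>\<^sup>n\<close> and countable dense subsets of
  \<open>E\<close> and \<open>F\<close> gives a chain \<open>f\<^sub>n : X\<^sub>n \<rightarrow> F\<close> whose consecutive members differ by at most
  \<open>2 (e\<^sub>n - e\<^sub>n\<^sub>+\<^sub>1) \<parallel>x\<parallel>\<close>, a telescoping bound. The limits \<open>lim f\<^sub>k (x\<^sub>k)\<close> over convergent sequences with
  \<open>x\<^sub>k \<in> X\<^sub>k\<close> define the isometry \<open>h\<close> in one stroke: the relation between \<open>lim x\<^sub>k\<close> and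
  \<open>lim f\<^sub>k (x\<^sub>k)\<close> is linear and preserves every semi-norm, and completeness makes it total on both sides
  (lemma \<open>limit_isometry\<close>). The telescoping sum gives \<open>\<parallel>h x - f x\<parallel> \<le> 2 \<epsilon> \<parallel>x\<parallel>\<close>, better than the
  constant \<open>4\<close> and strict enough whenever \<open>\<parallel>x\<parallel> \<noteq> 0\<close>.

  The estimates are made with the semi-norms directly; the topology enters only through
  \<open>graded_frechet_space_iff\<close> and \<open>separable_dense_sequence\<close>, which translate it into semi-norms.
\<close>

section \<open>Graded semi-norms and their topology\<close>

definition seminorm_limit :: "(nat \<Rightarrow> 'a::real_vector \<Rightarrow> real) \<Rightarrow> (nat \<Rightarrow> 'a) \<Rightarrow> 'a \<Rightarrow> bool" where
  "seminorm_limit p \<sigma> l \<longleftrightarrow> (\<forall>i. (\<lambda>n. p i (\<sigma> n - l)) \<longlonglongrightarrow> 0)"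

definition seminorm_Cauchy :: "(nat \<Rightarrow> 'a::real_vector \<Rightarrow> real) \<Rightarrow> (nat \<Rightarrow> 'a) \<Rightarrow> bool" where
  "seminorm_Cauchy p \<sigma> \<longleftrightarrow> (\<forall>i. \<forall>e>0. \<exists>N. \<forall>m\<ge>N. \<forall>n\<ge>N. p i (\<sigma> m - \<sigma> n) < e)"

locale graded_seminorms =
  fixes S :: "'a::real_vector set" and p :: "nat \<Rightarrow> 'a \<Rightarrow> real"
  assumes subspace: "subspace S"
    and seminorm: "seminorm_on S (p i)"
    and graded: "x \<in> S \<Longrightarrow> p i x \<le> p (Suc i) x"
begin

lemma mem [simp]:
  "0 \<in> S"
  "x \<in> S \<Longrightarrow> y \<in> S \<Longrightarrow> x + y \<in> S"
  "x \<in> S \<Longrightarrow> y \<in> S \<Longrightarrow> x - y \<in> S"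
  "x \<in> S \<Longrightarrow> c *\<^sub>R x \<in> S"
  "x \<in> S \<Longrightarrow> - x \<in> S"
  using subspace by (auto simp: subspace_0 subspace_add subspace_diff subspace_scale subspace_neg)

lemma nonneg [simp]: "x \<in> S \<Longrightarrow> 0 \<le> p i x"
  and scale: "x \<in> S \<Longrightarrow> p i (c *\<^sub>R x) = \<bar>c\<bar> * p i x"
  and triangle: "x \<in> S \<Longrightarrow> y \<in> S \<Longrightarrow> p i (x + y) \<le> p i x + p i y"
  using seminorm[of i] unfolding seminorm_on_def by auto

lemma zero [simp]: "p i 0 = 0"
  using scale[of 0 i 0] by simp

lemma minus [simp]: "x \<in> S \<Longrightarrow> p i (- x) = p i x"
  using scale[of x i "-1"] by simp

lemma commute: "x \<in> S \<Longrightarrow> y \<in> S \<Longrightarrow> p i (x - y) = p i (y - x)"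
  using minus[of "x - y" i] by simp

lemma triangle3: "x \<in> S \<Longrightarrow> y \<in> S \<Longrightarrow> z \<in> S \<Longrightarrow> p i (x - z) \<le> p i (x - y) + p i (y - z)"
  using triangle[of "x - y" "y - z" i] by simp

lemma reverse_triangle: "x \<in> S \<Longrightarrow> y \<in> S \<Longrightarrow> \<bar>p i x - p i y\<bar> \<le> p i (x - y)"
  using triangle[of "x - y" y i] triangle[of "y - x" x i] commute[of x y i] by simp

lemma mono: "i \<le> j \<Longrightarrow> x \<in> S \<Longrightarrow> p i x \<le> p j x"
  by (rule lift_Suc_mono_le[of "\<lambda>i. p i x"]) (rule graded)

lemma restrict:
  assumes "subspace T" "T \<subseteq> S"
  shows "graded_seminorms T p"
proof
  show "seminorm_on T (p i)" for i
    unfolding seminorm_on_def using subsetD[OF assms(2)] by (simp add: scale triangle)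
  show "p i x \<le> p (Suc i) x" if "x \<in> T" for i x
    using graded subsetD[OF assms(2) that] by blast
qed fact

lemma openin_seminorm_ball:
  assumes "x \<in> S" "0 < e"
  shows "openin (seminorm_topology S p) {y \<in> S. p i (y - x) < e}"
  unfolding seminorm_topology_def by (rule topology_generated_by_Basis) (use assms in blast)

text \<open>
  Because the semi-norms increase, finitely many balls around a point contain a ball of a single
  semi-norm, so such balls form a neighbourhood base.
\<close>

lemma openin_seminorm_topology:
  "openin (seminorm_topology S p) U \<longleftrightarrow>
     U \<subseteq> S \<and> (\<forall>x\<in>U. \<exists>i. \<exists>e>0. \<forall>y\<in>S. p i (y - x) < e \<longrightarrow> y \<in> U)" (is "_ \<longleftrightarrow> ?R U")
proof
  assume "openin (seminorm_topology S p) U"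
  then have "generate_topology_on {{y \<in> S. p i (y - x) < e} | i x e. x \<in> S \<and> 0 < e} U"
    unfolding seminorm_topology_def openin_topology_generated_by_iff .
  then show "?R U"
  proof (induction rule: generate_topology_on.induct)
    case (Int U V)
    show ?case
    proof (intro conjI ballI)
      show "U \<inter> V \<subseteq> S" using Int by blast
      fix x assume x: "x \<in> U \<inter> V"
      then have "x \<in> S" using Int by blast
      obtain i e where e: "e > 0" "\<forall>y\<in>S. p i (y - x) < e \<longrightarrow> y \<in> U"
        using bspec[OF conjunct2[OF Int.IH(1)] IntD1[OF x]] by blast
      obtain j d where d: "d > 0" "\<forall>y\<in>S. p j (y - x) < d \<longrightarrow> y \<in> V"
        using bspec[OF conjunct2[OF Int.IH(2)] IntD2[OF x]] by blast
      have "y \<in> U \<inter> V" if "y \<in> S" "p (max i j) (y - x) < min e d" for y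
        using bspec[OF e(2), of y] bspec[OF d(2), of y] that \<open>x \<in> S\<close> mono[of i "max i j" "y - x"] mono[of j "max i j" "y - x"]
        by simp
      then show "\<exists>i. \<exists>e>0. \<forall>y\<in>S. p i (y - x) < e \<longrightarrow> y \<in> U \<inter> V"
        using e(1) d(1) by (intro exI[of _ "max i j"] exI[of _ "min e d"]) auto
    qed
  next
    case (UN K)
    show ?case
    proof (intro conjI ballI)
      show "\<Union> K \<subseteq> S" using UN by blast
      fix x assume "x \<in> \<Union> K"
      then obtain k where k: "k \<in> K" "x \<in> k" by blast
      then obtain i e where "e > 0" "\<forall>y\<in>S. p i (y - x) < e \<longrightarrow> y \<in> k" using bspec[OF conjunct2[OF UN.IH[OF k(1)]] k(2)] by blast
      then have "\<forall>y\<in>S. p i (y - x) < e \<longrightarrow> y \<in> \<Union> K" using k(1) by blast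
      with \<open>e > 0\<close> show "\<exists>i. \<exists>e>0. \<forall>y\<in>S. p i (y - x) < e \<longrightarrow> y \<in> \<Union> K" by blast
    qed
  next
    case (Basis s)
    then obtain i z e where s: "s = {y \<in> S. p i (y - z) < e}" "z \<in> S" "0 < e" by blast
    have "y \<in> s" if "x \<in> s" "y \<in> S" "p i (y - x) < e - p i (x - z)" for x y
      using that triangle3[of y x z i] \<open>z \<in> S\<close> unfolding s(1) by simp
    moreover have "e - p i (x - z) > 0" if "x \<in> s" for x using that unfolding s(1) by simp
    moreover have "s \<subseteq> S" unfolding s(1) by blast
    ultimately show ?case by metis
  qed simp
next
  assume R: "?R U"
  then obtain I d where d: "\<And>x. x \<in> U \<Longrightarrow> d x > 0"
    "\<And>x y. x \<in> U \<Longrightarrow> y \<in> S \<Longrightarrow> p (I x) (y - x) < d x \<Longrightarrow> y \<in> U" by metis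
  let ?B = "\<lambda>x. {y \<in> S. p (I x) (y - x) < d x}"
  have US: "x \<in> S" if "x \<in> U" for x using R that by blast
  have "x \<in> ?B x" if "x \<in> U" for x using d(1)[OF that] US[OF that] by simp
  moreover have "?B x \<subseteq> U" if "x \<in> U" for x using d(2)[OF that] by blast
  ultimately have "\<Union> (?B ` U) = U" by blast
  moreover have "openin (seminorm_topology S p) (\<Union> (?B ` U))"
    by (rule openin_Union) (auto intro: openin_seminorm_ball d(1) US)
  ultimately show "openin (seminorm_topology S p) U" by simp
qed

lemma limitin_seminorm_topology:
  assumes \<sigma>: "\<And>n. \<sigma> n \<in> S"
  shows "limitin (seminorm_topology S p) \<sigma> l sequentially \<longleftrightarrow> l \<in> S \<and> seminorm_limit p \<sigma> l"
proof safe
  assume L: "limitin (seminorm_topology S p) \<sigma> l sequentially"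
  then show l: "l \<in> S" using limitin_topspace by fastforce
  have "\<forall>\<^sub>F n in sequentially. p i (\<sigma> n - l) < e" if "0 < e" for i e
  proof -
    have "\<forall>\<^sub>F n in sequentially. \<sigma> n \<in> {y \<in> S. p i (y - l) < e}"
    proof -
      have "l \<in> {y \<in> S. p i (y - l) < e}" using l that by simp
      then show ?thesis
        using L openin_seminorm_ball[OF l that, of i] unfolding limitin_def by blast
    qed
    then show ?thesis by eventually_elim simp
  qed
  then show "seminorm_limit p \<sigma> l"
    unfolding seminorm_limit_def tendsto_iff by (simp add: l \<sigma>)
next
  assume l: "l \<in> S" "seminorm_limit p \<sigma> l"
  show "limitin (seminorm_topology S p) \<sigma> l sequentially"
    unfolding limitin_def
  proof (intro conjI allI impI)
    fix U assume "openin (seminorm_topology S p) U \<and> l \<in> U"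
    then obtain i e where e: "e > 0" "\<And>y. y \<in> S \<Longrightarrow> p i (y - l) < e \<Longrightarrow> y \<in> U"
      unfolding openin_seminorm_topology by metis
    have "(\<lambda>n. p i (\<sigma> n - l)) \<longlonglongrightarrow> 0" using l(2) unfolding seminorm_limit_def by blast
    then have "\<forall>\<^sub>F n in sequentially. p i (\<sigma> n - l) < e"
      using e(1) by (rule order_tendstoD)
    then show "\<forall>\<^sub>F n in sequentially. \<sigma> n \<in> U"
      by eventually_elim (rule e(2)[OF \<sigma>])
  qed (use l in simp)
qed

lemma seminorm_limit_imp_Cauchy:
  assumes \<sigma>: "\<And>n. \<sigma> n \<in> S" and l: "l \<in> S" "seminorm_limit p \<sigma> l"
  shows "seminorm_Cauchy p \<sigma>"
  unfolding seminorm_Cauchy_def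
proof (intro allI impI)
  fix i and e :: real assume "0 < e"
  have "(\<lambda>n. p i (\<sigma> n - l)) \<longlonglongrightarrow> 0" using l(2) unfolding seminorm_limit_def by blast
  then have "\<forall>\<^sub>F n in sequentially. p i (\<sigma> n - l) < e / 2"
    by (rule order_tendstoD) (use \<open>0 < e\<close> in simp)
  then obtain N where N: "\<And>n. n \<ge> N \<Longrightarrow> p i (\<sigma> n - l) < e / 2"
    by (auto simp: eventually_sequentially)
  have "p i (\<sigma> m - \<sigma> n) < e" if "m \<ge> N" "n \<ge> N" for m n
    using N[OF that(1)] N[OF that(2)] triangle3[of "\<sigma> m" l "\<sigma> n" i] commute[of l "\<sigma> n" i] \<sigma> l(1)
    by simp
  then show "\<exists>N. \<forall>m\<ge>N. \<forall>n\<ge>N. p i (\<sigma> m - \<sigma> n) < e" by (intro exI[of _ N]) simp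
qed

lemma seminorm_limit_value:
  assumes \<sigma>: "\<And>n. \<sigma> n \<in> S" and l: "l \<in> S" "seminorm_limit p \<sigma> l"
  shows "(\<lambda>n. p i (\<sigma> n)) \<longlonglongrightarrow> p i l"
proof -
  have "(\<lambda>n. p i (\<sigma> n) - p i l) \<longlonglongrightarrow> 0"
  proof (rule Lim_null_comparison)
    show "\<forall>\<^sub>F n in sequentially. norm (p i (\<sigma> n) - p i l) \<le> p i (\<sigma> n - l)"
      using reverse_triangle[OF \<sigma> l(1), of i] by simp
    show "(\<lambda>n. p i (\<sigma> n - l)) \<longlonglongrightarrow> 0" using l(2) unfolding seminorm_limit_def by blast
  qed
  then show ?thesis by (simp add: LIM_zero_iff)
qed

lemma seminorm_limit_add:
  assumes "\<And>n. \<sigma> n \<in> S" "\<And>n. \<tau> n \<in> S" "x \<in> S" "y \<in> S"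
    and "seminorm_limit p \<sigma> x" "seminorm_limit p \<tau> y"
  shows "seminorm_limit p (\<lambda>n. \<sigma> n + \<tau> n) (x + y)"
  unfolding seminorm_limit_def
proof
  fix i
  show "(\<lambda>n. p i (\<sigma> n + \<tau> n - (x + y))) \<longlonglongrightarrow> 0"
  proof (rule Lim_null_comparison)
    show "\<forall>\<^sub>F n in sequentially. norm (p i (\<sigma> n + \<tau> n - (x + y))) \<le> p i (\<sigma> n - x) + p i (\<tau> n - y)"
      using triangle[of "\<sigma> _ - x" "\<tau> _ - y" i] assms(1-4) by (simp add: add_diff_add)
    show "(\<lambda>n. p i (\<sigma> n - x) + p i (\<tau> n - y)) \<longlonglongrightarrow> 0"
      using assms(5,6) tendsto_add[of "\<lambda>n. p i (\<sigma> n - x)" 0 _ "\<lambda>n. p i (\<tau> n - y)" 0]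
      unfolding seminorm_limit_def by simp
  qed
qed

lemma seminorm_limit_scale:
  assumes "\<And>n. \<sigma> n \<in> S" "x \<in> S" "seminorm_limit p \<sigma> x"
  shows "seminorm_limit p (\<lambda>n. c *\<^sub>R \<sigma> n) (c *\<^sub>R x)"
  using assms tendsto_mult_right_zero[of "\<lambda>n. p _ (\<sigma> n - x)" _ "\<bar>c\<bar>"]
  unfolding seminorm_limit_def by (simp add: scale flip: scaleR_diff_right)

text \<open>
  A metric for the topology. With increasing semi-norms the supremum of the truncated terms
  \<open>min (p i (x - y)) (1 / (i + 1))\<close> is squeezed between its individual terms (lemma \<open>dist_ge\<close>) and
  \<open>max (p i (x - y)) (1 / (i + 1))\<close> (lemma \<open>dist_le\<close>), which is all that the comparison of the two
  topologies uses.
\<close>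

definition seminorm_dist :: "'a \<Rightarrow> 'a \<Rightarrow> real" where
  "seminorm_dist x y = (SUP i. min (p i (x - y)) (1 / (real i + 1)))"

lemma bdd_above_dist: "bdd_above (range (\<lambda>i. min (p i (x - y)) (1 / (real i + 1))))"
proof (rule bdd_aboveI2)
  show "min (p i (x - y)) (1 / (real i + 1)) \<le> 1" for i
    by (simp add: min.coboundedI2)
qed

lemma dist_ge: "min (p i (x - y)) (1 / (real i + 1)) \<le> seminorm_dist x y"
  unfolding seminorm_dist_def using bdd_above_dist by (rule cSUP_upper2[of _ _ i]) auto

lemma dist_le:
  assumes "x \<in> S" "y \<in> S"
  shows "seminorm_dist x y \<le> max (p i (x - y)) (1 / (real i + 1))"
  unfolding seminorm_dist_def
proof (rule cSUP_least)
  fix j :: nat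
  show "min (p j (x - y)) (1 / (real j + 1)) \<le> max (p i (x - y)) (1 / (real i + 1))"
  proof (cases "j \<le> i")
    case True
    then show ?thesis using mono[of j i "x - y"] assms by auto
  next
    case False
    then have "1 / (real j + 1) \<le> 1 / (real i + 1)" by (simp add: frac_le)
    then show ?thesis by auto
  qed
qed simp

text \<open>
  Needed so that the finite-dimensional amalgams constructed below qualify as Frechet spaces.
\<close>

lemma metrizable_seminorm_topology:
  assumes separating: "\<And>x. x \<in> S \<Longrightarrow> (\<And>i. p i x = 0) \<Longrightarrow> x = 0"
  shows "metrizable_space (seminorm_topology S p)"
proof -
  have dist_nonneg: "0 \<le> seminorm_dist x y" if "x \<in> S" "y \<in> S" for x y
    using dist_ge[of 0 x y] nonneg[of "x - y" 0] that
    by (auto simp: min_def simp del: nonneg split: if_splits)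
  interpret M: Metric_space S "\<lambda>x y. if x \<in> S \<and> y \<in> S then seminorm_dist x y else 0"
  proof
    fix x y
    show "0 \<le> (if x \<in> S \<and> y \<in> S then seminorm_dist x y else 0)"
      using dist_nonneg by simp
    show "(if x \<in> S \<and> y \<in> S then seminorm_dist x y else 0) =
          (if y \<in> S \<and> x \<in> S then seminorm_dist y x else 0)"
      using commute[of x y] by (simp add: seminorm_dist_def)
  next
    fix x y assume xy: "x \<in> S" "y \<in> S"
    show "((if x \<in> S \<and> y \<in> S then seminorm_dist x y else 0) = 0) = (x = y)"
    proof
      assume "(if x \<in> S \<and> y \<in> S then seminorm_dist x y else 0) = 0"
      then have "p i (x - y) = 0" for i
      proof -
        have "0 < 1 / (real i + 1)" by simp
        then show ?thesis
          using dist_ge[of i x y] xy \<open>_ = 0\<close> order.antisym[OF _ nonneg[of "x - y" i]]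
          by (auto simp: min_def split: if_splits)
      qed
      then show "x = y" using separating[of "x - y"] xy by simp
    next
      assume "x = y"
      then show "(if x \<in> S \<and> y \<in> S then seminorm_dist x y else 0) = 0"
        by (simp add: seminorm_dist_def)
    qed
  next
    fix x y z assume xyz: "x \<in> S" "y \<in> S" "z \<in> S"
    have "seminorm_dist x z \<le> seminorm_dist x y + seminorm_dist y z"
      unfolding seminorm_dist_def[of x z]
    proof (rule cSUP_least)
      fix i :: nat
      show "min (p i (x - z)) (1 / (real i + 1)) \<le> seminorm_dist x y + seminorm_dist y z"
        using dist_ge[of i x y] dist_ge[of i y z] triangle3[of x y z i] xyz
          dist_nonneg[of x y] dist_nonneg[of y z] nonneg[of "x - y" i] nonneg[of "y - z" i]
        by (auto simp: min_def split: if_splits)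
    qed simp
    then show "(if x \<in> S \<and> z \<in> S then seminorm_dist x z else 0)
        \<le> (if x \<in> S \<and> y \<in> S then seminorm_dist x y else 0) +
          (if y \<in> S \<and> z \<in> S then seminorm_dist y z else 0)"
      using xyz by simp
  qed
  have "openin (seminorm_topology S p) U \<longleftrightarrow> openin M.mtopology U" for U
  proof -
    have ball_iff: "(\<exists>i. \<exists>e>0. \<forall>y\<in>S. p i (y - x) < e \<longrightarrow> y \<in> U) \<longleftrightarrow> (\<exists>r>0. M.mball x r \<subseteq> U)"
      if x: "x \<in> S" for x
    proof
      assume "\<exists>i. \<exists>e>0. \<forall>y\<in>S. p i (y - x) < e \<longrightarrow> y \<in> U"
      then obtain i e where e: "e > 0" "\<And>y. y \<in> S \<Longrightarrow> p i (y - x) < e \<Longrightarrow> y \<in> U" by blast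
      have "M.mball x (min e (1 / (real i + 1))) \<subseteq> U"
      proof
        fix y assume "y \<in> M.mball x (min e (1 / (real i + 1)))"
        then have y: "y \<in> S" "seminorm_dist x y < min e (1 / (real i + 1))" using x by auto
        then have "p i (x - y) < e" using dist_ge[of i x y] by linarith
        then show "y \<in> U" using e(2)[of y] y(1) x commute[of x y i] by simp
      qed
      then show "\<exists>r>0. M.mball x r \<subseteq> U" using e(1) by (intro exI[of _ "min e (1 / (real i + 1))"]) auto
    next
      assume "\<exists>r>0. M.mball x r \<subseteq> U"
      then obtain r where r: "r > 0" "M.mball x r \<subseteq> U" by blast
      obtain i where i: "1 / (real i + 1) < r"
        using r(1) reals_Archimedean[of r] by (auto simp: inverse_eq_divide add.commute)
      have "y \<in> U" if "y \<in> S" "p i (y - x) < r" for y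
      proof -
        have "seminorm_dist x y < r"
          using dist_le[of x y i] i that x commute[of x y i] by simp
        then show ?thesis using r(2) that x by auto
      qed
      then show "\<exists>i. \<exists>e>0. \<forall>y\<in>S. p i (y - x) < e \<longrightarrow> y \<in> U" using r(1) by blast
    qed
    show ?thesis
      unfolding openin_seminorm_topology M.openin_mtopology Ball_def[of U]
      by (intro conj_cong iff_allI imp_cong refl ball_iff) (erule subsetD)
  qed
  then have "seminorm_topology S p = M.mtopology" by (simp add: topology_eq)
  then show ?thesis using M.metrizable_space_mtopology by simp
qed

end

text \<open>
  Frechet spaces in terms of the semi-norms only: metrizability amounts to separation of points, and
  completeness to convergence of Cauchy sequences in every semi-norm.
\<close>

locale graded_frechet = graded_seminorms +
  assumes separating: "x \<in> S \<Longrightarrow> (\<And>i. p i x = 0) \<Longrightarrow> x = 0"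
    and complete: "(\<And>n :: nat. \<sigma> n \<in> S) \<Longrightarrow> seminorm_Cauchy p \<sigma> \<Longrightarrow> \<exists>l\<in>S. seminorm_limit p \<sigma> l"

lemma graded_frechet_space_iff: "graded_frechet_space S p \<longleftrightarrow> graded_frechet S p"
proof
  assume S: "graded_frechet_space S p"
  then interpret graded_seminorms S p
    by unfold_locales (auto simp: graded_frechet_space_def frechet_space_def)
  show "graded_frechet S p"
  proof
    fix x assume x: "x \<in> S" "\<And>i. p i x = 0"
    show "x = 0"
    proof (rule ccontr)
      assume "x \<noteq> 0"
      have "Hausdorff_space (seminorm_topology S p)"
        using S by (simp add: graded_frechet_space_def frechet_space_def metrizable_imp_Hausdorff_space)
      then obtain U V where UV: "openin (seminorm_topology S p) U" "0 \<in> U" "x \<in> V" "disjnt U V"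
        using x(1) \<open>x \<noteq> 0\<close> unfolding Hausdorff_space_def
        by (metis mem(1) topspace_seminorm_topology)
      then have "x \<in> U"
        unfolding openin_seminorm_topology using x by fastforce
      with UV show False unfolding disjnt_def by blast
    qed
  next
    fix \<sigma> assume \<sigma>: "\<And>n. \<sigma> n \<in> S" "seminorm_Cauchy p \<sigma>"
    then have "range \<sigma> \<subseteq> S" by blast
    then obtain l where "limitin (seminorm_topology S p) \<sigma> l sequentially"
      using S \<sigma>(2) unfolding graded_frechet_space_def frechet_space_def seminorm_Cauchy_def by blast
    then show "\<exists>l\<in>S. seminorm_limit p \<sigma> l"
      using limitin_seminorm_topology \<sigma>(1) by blast
  qed
next
  assume "graded_frechet S p"
  then interpret graded_frechet S p .
  show "graded_frechet_space S p"
    unfolding graded_frechet_space_def frechet_space_def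
  proof (intro conjI allI impI)
    show "metrizable_space (seminorm_topology S p)"
      using separating by (rule metrizable_seminorm_topology)
    fix \<sigma> :: "nat \<Rightarrow> 'a"
    assume "range \<sigma> \<subseteq> S \<and> (\<forall>i. \<forall>e>0. \<exists>N. \<forall>m\<ge>N. \<forall>n\<ge>N. p i (\<sigma> m - \<sigma> n) < e)"
    then have \<sigma>: "\<And>n. \<sigma> n \<in> S" "seminorm_Cauchy p \<sigma>" unfolding seminorm_Cauchy_def by blast+
    then show "\<exists>l. limitin (seminorm_topology S p) \<sigma> l sequentially"
      using complete[OF \<sigma>] limitin_seminorm_topology[of \<sigma>] by blast
  qed (use subspace seminorm graded in auto)
qed

text \<open>
  In finite dimensions completeness comes for free. The induction adds a generator \<open>b\<close> to a complete
  subspace \<open>span B\<close>: if \<open>b\<close> were at distance zero from \<open>span B\<close> in every semi-norm, then gradedness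
  would provide a single sequence of \<open>span B\<close> converging to \<open>b\<close>, and completeness would put \<open>b\<close> into
  \<open>span B\<close>. So some semi-norm keeps \<open>b\<close> away from \<open>span B\<close>, the coordinate along \<open>b\<close> is bounded by that
  semi-norm, and a Cauchy sequence splits into two Cauchy sequences.
\<close>

lemma finite_dimensional_graded_frechet:
  assumes "graded_seminorms S p" and "finite_dimensional S"
    and separating: "\<And>x. x \<in> S \<Longrightarrow> (\<And>i. p i x = 0) \<Longrightarrow> x = 0"
  shows "graded_frechet S p"
proof -
  interpret graded_seminorms S p by fact
  have complete: "\<exists>l\<in>span B. seminorm_limit p \<sigma> l"
    if "finite B" "B \<subseteq> S" "\<And>n. \<sigma> n \<in> span B" "seminorm_Cauchy p \<sigma>" for B \<sigma>
    using that
  proof (induction B arbitrary: \<sigma> rule: finite_induct)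
    case empty
    then have "\<sigma> n = 0" for n by simp
    then show ?case unfolding seminorm_limit_def by simp
  next
    case (insert b B)
    have b: "b \<in> S" using insert.prems(1) by simp
    have BS: "span B \<subseteq> S"
      by (rule span_minimal) (use insert.prems(1) subspace in auto)
    show ?case
    proof (cases "b \<in> span B")
      case True
      then have "span (insert b B) = span B" by (rule span_redundant)
      then show ?thesis using insert by auto
    next
      case False
      have "\<exists>i. \<exists>\<delta>>0. \<forall>s\<in>span B. \<delta> \<le> p i (b - s)"
      proof (rule ccontr)
        assume "\<not> ?thesis"
        then have "\<forall>n. \<exists>s\<in>span B. p n (b - s) < 1 / (real n + 1)"
          by (metis not_less of_nat_0_le_iff add_nonneg_pos zero_less_one divide_pos_pos)
        then obtain s where s: "\<And>n. s n \<in> span B" "\<And>n. p n (b - s n) < 1 / (real n + 1)" by metis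
        then have sS: "s n \<in> S" for n using BS by blast
        have lim_b: "seminorm_limit p s b"
          unfolding seminorm_limit_def
        proof
          fix i
          show "(\<lambda>n. p i (s n - b)) \<longlonglongrightarrow> 0"
          proof (rule Lim_null_comparison)
            have "p i (s n - b) \<le> 1 / (real n + 1)" if "n \<ge> i" for n
              using mono[OF that, of "s n - b"] s(2)[of n] sS b commute[of b "s n" n] by simp
            then show "\<forall>\<^sub>F n in sequentially. norm (p i (s n - b)) \<le> 1 / (real n + 1)"
              using sS b by (intro eventually_sequentiallyI[of i]) simp
            show "(\<lambda>n. 1 / (real n + 1)) \<longlonglongrightarrow> 0"
              using LIMSEQ_inverse_real_of_nat by (simp add: inverse_eq_divide add.commute)
          qed
        qed
        then obtain l where l: "l \<in> span B" "seminorm_limit p s l"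
          using insert.IH[of s] insert.prems(1) s(1) seminorm_limit_imp_Cauchy[of s b] sS b by auto
        have lS: "l \<in> S" using l(1) BS by blast
        have "p i (b - l) = 0" for i
        proof -
          have "(\<lambda>n. p i (s n - b) + p i (s n - l)) \<longlonglongrightarrow> 0 + 0"
            using lim_b l(2) unfolding seminorm_limit_def by (intro tendsto_add) auto
          moreover have "p i (b - l) \<le> p i (s n - b) + p i (s n - l)" for n
            using triangle3[of b "s n" l i] commute[of b "s n" i] sS b lS by simp
          ultimately have "p i (b - l) \<le> 0"
            using LIMSEQ_le_const[of _ 0 "p i (b - l)"] by simp
          then show ?thesis using order.antisym[OF _ nonneg[of "b - l" i]] b lS by simp
        qed
        then have "b = l" using separating[of "b - l"] b lS by simp
        with l(1) False show False by simp
      qed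
      then obtain i \<delta> where \<delta>: "\<delta> > 0" "\<And>s. s \<in> span B \<Longrightarrow> \<delta> \<le> p i (b - s)" by blast
      have coord: "\<bar>c\<bar> * \<delta> \<le> p i (c *\<^sub>R b + s)" if s: "s \<in> span B" for c s
      proof (cases "c = 0")
        case True
        then show ?thesis using subsetD[OF BS s] by simp
      next
        case False
        have "c *\<^sub>R b + s = c *\<^sub>R (b - (- (1 / c)) *\<^sub>R s)" using False by (simp add: algebra_simps)
        then have "p i (c *\<^sub>R b + s) = \<bar>c\<bar> * p i (b - (- (1 / c)) *\<^sub>R s)"
          using scale[of "b - (- (1 / c)) *\<^sub>R s" i c] b subsetD[OF BS s] by (simp del: scaleR_minus_left)
        then show ?thesis using \<delta>(2)[of "(- (1 / c)) *\<^sub>R s"] s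
          by (simp add: mult_left_mono span_scale del: scaleR_minus_left)
      qed
      have "\<exists>c. \<sigma> n - c *\<^sub>R b \<in> span B" for n
        using insert.prems(2)[of n] by (simp add: span_breakdown_eq)
      then obtain c where c: "\<And>n. \<sigma> n - c n *\<^sub>R b \<in> span B" by metis
      define s where "s n = \<sigma> n - c n *\<^sub>R b" for n
      have sB: "s n \<in> span B" for n using c by (simp add: s_def)
      have sS: "s n \<in> S" for n using sB BS by blast
      have \<sigma>_eq: "\<sigma> n = c n *\<^sub>R b + s n" for n by (simp add: s_def)
      have "Cauchy c"
      proof (rule metric_CauchyI)
        fix e :: real assume "0 < e"
        then obtain N where N: "\<And>m n. m \<ge> N \<Longrightarrow> n \<ge> N \<Longrightarrow> p i (\<sigma> m - \<sigma> n) < e * \<delta>"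
          using insert.prems(3) \<delta>(1) unfolding seminorm_Cauchy_def by (meson mult_pos_pos)
        have "dist (c m) (c n) < e" if "m \<ge> N" "n \<ge> N" for m n
        proof -
          have "\<sigma> m - \<sigma> n = (c m - c n) *\<^sub>R b + (s m - s n)" by (simp add: \<sigma>_eq algebra_simps)
          then have "\<bar>c m - c n\<bar> * \<delta> < e * \<delta>"
            using coord[of "s m - s n" "c m - c n"] N[OF that] sB by (simp add: span_diff)
          then show ?thesis using \<delta>(1) by (simp add: dist_real_def)
        qed
        then show "\<exists>M. \<forall>m\<ge>M. \<forall>n\<ge>M. dist (c m) (c n) < e" by blast
      qed
      then obtain c0 where "c \<longlonglongrightarrow> c0" using Cauchy_convergent convergent_def by blast
      then have cb: "seminorm_limit p (\<lambda>n. c n *\<^sub>R b) (c0 *\<^sub>R b)"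
        unfolding seminorm_limit_def
        by (auto simp: b scale simp flip: scaleR_diff_left
             intro!: tendsto_mult_left_zero tendsto_rabs_zero LIM_zero)
      have "seminorm_Cauchy p s"
        unfolding seminorm_Cauchy_def
      proof (intro allI impI)
        fix j and e :: real assume "0 < e"
        have "seminorm_Cauchy p (\<lambda>n. c n *\<^sub>R b)"
          using seminorm_limit_imp_Cauchy[of "\<lambda>n. c n *\<^sub>R b", OF _ _ cb] b by simp
        then obtain N where N: "\<And>m n. m \<ge> N \<Longrightarrow> n \<ge> N \<Longrightarrow> p j (c m *\<^sub>R b - c n *\<^sub>R b) < e / 2"
          using \<open>0 < e\<close> unfolding seminorm_Cauchy_def by (meson half_gt_zero)
        obtain M where M: "\<And>m n. m \<ge> M \<Longrightarrow> n \<ge> M \<Longrightarrow> p j (\<sigma> m - \<sigma> n) < e / 2"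
          using insert.prems(3) \<open>0 < e\<close> unfolding seminorm_Cauchy_def by (meson half_gt_zero)
        have "p j (s m - s n) < e" if "m \<ge> max M N" "n \<ge> max M N" for m n
        proof -
          have "s m - s n = (\<sigma> m - \<sigma> n) + (c n *\<^sub>R b - c m *\<^sub>R b)" by (simp add: \<sigma>_eq algebra_simps)
          moreover have "\<sigma> n \<in> S" for n using b sS by (simp add: \<sigma>_eq)
          ultimately show ?thesis
            using triangle[of "\<sigma> m - \<sigma> n" "c n *\<^sub>R b - c m *\<^sub>R b" j] M[of m n] N[of n m] that b by simp
        qed
        then show "\<exists>N. \<forall>m\<ge>N. \<forall>n\<ge>N. p j (s m - s n) < e" by blast
      qed
      then obtain l where l: "l \<in> span B" "seminorm_limit p s l"
        using insert.IH[of s] insert.prems(1) sB by auto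
      have "seminorm_limit p (\<lambda>n. c n *\<^sub>R b + s n) (c0 *\<^sub>R b + l)"
        by (rule seminorm_limit_add) (use b sS l subsetD[OF BS] cb in auto)
      moreover have "(\<lambda>n. c n *\<^sub>R b + s n) = \<sigma>" by (simp add: s_def)
      moreover have "c0 *\<^sub>R b + l \<in> span (insert b B)"
        using l(1) by (simp add: span_breakdown_eq[of "c0 *\<^sub>R b + l"]) (metis add_diff_cancel_left')
      ultimately show ?thesis by metis
    qed
  qed
  obtain B where "finite B" "S = span B" using assms(2) unfolding finite_dimensional_def by blast
  show ?thesis
  proof
    fix \<sigma> assume "\<And>n. \<sigma> n \<in> S" "seminorm_Cauchy p \<sigma>"
    then show "\<exists>l\<in>S. seminorm_limit p \<sigma> l"
      using complete[of B \<sigma>] \<open>finite B\<close> \<open>S = span B\<close> span_superset by auto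
  qed (use separating in blast)
qed

section \<open>Amalgamating two spaces along an almost isometry\<close>

text \<open>
  The largest semi-norm on \<open>X \<times> Y\<close> that is at most \<open>p i\<close> on \<open>X\<close>, at most \<open>q i\<close> on \<open>Y\<close> and at most
  \<open>e * p i w\<close> at \<open>(w, - f w)\<close>: a pair \<open>(x, y)\<close> is written as
  \<open>(x - w, 0) + (0, y + f w) + (w, - f w)\<close>, and the three costs are added.
\<close>

definition amalgam_seminorm ::
    "'a::real_vector set \<Rightarrow> (nat \<Rightarrow> 'a \<Rightarrow> real) \<Rightarrow> (nat \<Rightarrow> 'b::real_vector \<Rightarrow> real) \<Rightarrow> ('a \<Rightarrow> 'b) \<Rightarrow> real \<Rightarrow>
     nat \<Rightarrow> 'a \<times> 'b \<Rightarrow> real" where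
  "amalgam_seminorm X p q f e i z = (INF w\<in>X. p i (fst z - w) + q i (snd z + f w) + e * p i w)"

locale almost_isometry = X: graded_seminorms X p + Y: graded_seminorms Y q
  for X :: "'a::real_vector set" and p and Y :: "'b::real_vector set" and q +
  fixes f :: "'a \<Rightarrow> 'b" and e :: real
  assumes e_pos: "0 < e" and f: "eps_isometric_embedding e X p Y q f"
begin

lemma f_mem [simp]: "x \<in> X \<Longrightarrow> f x \<in> Y"
  and f_add: "x \<in> X \<Longrightarrow> y \<in> X \<Longrightarrow> f (x + y) = f x + f y"
  and f_scale: "x \<in> X \<Longrightarrow> f (c *\<^sub>R x) = c *\<^sub>R f x"
  and f_upper: "x \<in> X \<Longrightarrow> q i (f x) \<le> (1 + e) * p i x"
  using f unfolding eps_isometric_embedding_def linear_on_def by auto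

lemma f_lower: "x \<in> X \<Longrightarrow> p i x \<le> (1 + e) * q i (f x)"
  using f e_pos unfolding eps_isometric_embedding_def by (simp add: field_simps)

lemma f_zero [simp]: "f 0 = 0"
  using f_scale[of 0 0] by simp

abbreviation N where "N \<equiv> amalgam_seminorm X p q f e"

lemma amalgam_le:
  assumes "x \<in> X" "y \<in> Y" "w \<in> X"
  shows "N i (x, y) \<le> p i (x - w) + q i (y + f w) + e * p i w"
  unfolding amalgam_seminorm_def fst_conv snd_conv
proof (rule cINF_lower[OF bdd_belowI2[where m = 0]])
  fix w assume "w \<in> X"
  then show "0 \<le> p i (x - w) + q i (y + f w) + e * p i w"
    using assms e_pos by (intro add_nonneg_nonneg mult_nonneg_nonneg) auto
qed fact

lemma amalgam_ge:
  assumes "\<And>w. w \<in> X \<Longrightarrow> c \<le> p i (x - w) + q i (y + f w) + e * p i w"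
  shows "c \<le> N i (x, y)"
  unfolding amalgam_seminorm_def fst_conv snd_conv
  by (rule cINF_greatest[OF _ assms]) (use X.mem(1) in blast)

lemma amalgam_nonneg: "x \<in> X \<Longrightarrow> y \<in> Y \<Longrightarrow> 0 \<le> N i (x, y)"
  by (rule amalgam_ge) (use e_pos in \<open>auto intro!: add_nonneg_nonneg mult_nonneg_nonneg\<close>)

text \<open>
  Moving along the graph and back does not shorten vectors of \<open>X\<close>: the detour over \<open>w\<close> costs
  \<open>q i (f w) + e * p i w\<close>, which is at least \<open>p i w\<close> since \<open>1 / (1 + e) + e \<ge> 1\<close>. This is where the
  lower bound on \<open>f\<close> enters.
\<close>

lemma amalgam_fst:
  assumes x: "x \<in> X"
  shows "N i (x, 0) = p i x"
proof (rule order.antisym)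
  show "N i (x, 0) \<le> p i x" using amalgam_le[of x 0 0 i] x by simp
  show "p i x \<le> N i (x, 0)"
  proof (rule amalgam_ge)
    fix w assume w: "w \<in> X"
    have "inverse (1 + e) * p i w \<le> q i (f w)"
      using f w unfolding eps_isometric_embedding_def by blast
    moreover have "1 \<le> inverse (1 + e) + e" using e_pos by (simp add: field_simps)
    then have "1 * p i w \<le> (inverse (1 + e) + e) * p i w"
      by (rule mult_right_mono) (use w in simp)
    ultimately have "p i w \<le> q i (f w) + e * p i w" by (simp add: distrib_right)
    then show "p i x \<le> p i (x - w) + q i (0 + f w) + e * p i w"
      using X.triangle[of "x - w" w i] x w by simp
  qed
qed

text \<open>
  The mirror image of the preceding lemma: here the detour costs \<open>(1 + e) * p i w \<ge> q i (f w)\<close>, by the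
  upper bound on \<open>f\<close>.
\<close>

lemma amalgam_snd:
  assumes y: "y \<in> Y"
  shows "N i (0, y) = q i y"
proof (rule order.antisym)
  show "N i (0, y) \<le> q i y" using amalgam_le[of 0 y 0 i] y by simp
  show "q i y \<le> N i (0, y)"
  proof (rule amalgam_ge)
    fix w assume w: "w \<in> X"
    show "q i y \<le> p i (0 - w) + q i (y + f w) + e * p i w"
      using Y.triangle[of "y + f w" "- f w" i] f_upper[OF w, of i] y w by (simp add: distrib_right)
  qed
qed

lemma amalgam_graph: "x \<in> X \<Longrightarrow> N i (x, - f x) \<le> e * p i x"
  using amalgam_le[of x "- f x" x i] by simp

lemma amalgam_scale_le:
  assumes "x \<in> X" "y \<in> Y"
  shows "N i (c *\<^sub>R x, c *\<^sub>R y) \<le> \<bar>c\<bar> * N i (x, y)"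
proof (cases "c = 0")
  case True
  then show ?thesis using amalgam_snd[of 0] by simp
next
  case False
  have "N i (c *\<^sub>R x, c *\<^sub>R y) / \<bar>c\<bar> \<le> N i (x, y)"
  proof (rule amalgam_ge)
    fix w assume w: "w \<in> X"
    have "N i (c *\<^sub>R x, c *\<^sub>R y) \<le> p i (c *\<^sub>R x - c *\<^sub>R w) + q i (c *\<^sub>R y + f (c *\<^sub>R w)) + e * p i (c *\<^sub>R w)"
      by (rule amalgam_le) (use assms w in auto)
    also have "\<dots> = \<bar>c\<bar> * (p i (x - w) + q i (y + f w) + e * p i w)"
      using assms w X.scale[of "x - w" i c] Y.scale[of "y + f w" i c] X.scale[of w i c]
      by (simp add: f_scale algebra_simps)
    finally show "N i (c *\<^sub>R x, c *\<^sub>R y) / \<bar>c\<bar> \<le> p i (x - w) + q i (y + f w) + e * p i w"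
      using False by (simp add: field_simps)
  qed
  then show ?thesis using False by (simp add: field_simps)
qed

lemma amalgam_scale:
  assumes "x \<in> X" "y \<in> Y"
  shows "N i (c *\<^sub>R x, c *\<^sub>R y) = \<bar>c\<bar> * N i (x, y)"
proof (cases "c = 0")
  case True
  then show ?thesis using amalgam_snd[of 0] by simp
next
  case False
  have "N i (x, y) \<le> \<bar>1 / c\<bar> * N i (c *\<^sub>R x, c *\<^sub>R y)"
    using amalgam_scale_le[of "c *\<^sub>R x" "c *\<^sub>R y" i "1 / c"] assms False by simp
  then have "\<bar>c\<bar> * N i (x, y) \<le> N i (c *\<^sub>R x, c *\<^sub>R y)"
    using False by (simp add: field_simps)
  then show ?thesis using amalgam_scale_le[OF assms, of i c] by simp
qed

lemma amalgam_triangle: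
  assumes xy: "x \<in> X" "y \<in> Y" "x' \<in> X" "y' \<in> Y"
  shows "N i (x + x', y + y') \<le> N i (x, y) + N i (x', y')"
proof -
  have "N i (x + x', y + y') - N i (x', y') \<le> N i (x, y)"
  proof (rule amalgam_ge)
    fix w assume w: "w \<in> X"
    have "N i (x + x', y + y') - (p i (x - w) + q i (y + f w) + e * p i w) \<le> N i (x', y')"
    proof (rule amalgam_ge)
      fix w' assume w': "w' \<in> X"
      have "N i (x + x', y + y') \<le>
          p i ((x + x') - (w + w')) + q i ((y + y') + f (w + w')) + e * p i (w + w')"
        by (rule amalgam_le) (use xy w w' in auto)
      also have "(x + x') - (w + w') = (x - w) + (x' - w')" by simp
      also have "(y + y') + f (w + w') = (y + f w) + (y' + f w')" using w w' by (simp add: f_add)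
      also have "p i ((x - w) + (x' - w')) + q i ((y + f w) + (y' + f w')) + e * p i (w + w')
          \<le> (p i (x - w) + p i (x' - w')) + (q i (y + f w) + q i (y' + f w')) + e * (p i w + p i w')"
        using e_pos xy w w' by (intro add_mono mult_left_mono X.triangle Y.triangle) auto
      finally show "N i (x + x', y + y') - (p i (x - w) + q i (y + f w) + e * p i w)
          \<le> p i (x' - w') + q i (y' + f w') + e * p i w'"
        by (simp add: distrib_left)
    qed
    then show "N i (x + x', y + y') - N i (x', y') \<le> p i (x - w) + q i (y + f w) + e * p i w"
      by simp
  qed
  then show ?thesis by simp
qed

text \<open>
  The cost of moving along the graph is a fixed multiple of \<open>p i w\<close>, so no part of \<open>x\<close> can be moved
  to \<open>Y\<close> cheaply. Separation of points follows from this.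
\<close>

lemma amalgam_controls_fst:
  assumes "x \<in> X" "y \<in> Y"
  shows "p i x \<le> (1 + 1 / e) * N i (x, y)"
proof -
  have "e / (1 + e) * p i x \<le> N i (x, y)"
  proof (rule amalgam_ge)
    fix w assume w: "w \<in> X"
    have "e * p i x \<le> e * (p i (x - w) + p i w)"
      using e_pos X.triangle[of "x - w" w i] assms w by simp
    also have "\<dots> \<le> (1 + e) * (p i (x - w) + q i (y + f w) + e * p i w)"
    proof -
      have "0 \<le> p i (x - w)" "0 \<le> q i (y + f w)" "0 \<le> e * (e * p i w)" "0 \<le> e * q i (y + f w)"
        using assms w e_pos by (auto intro!: mult_nonneg_nonneg)
      then show ?thesis by (simp add: algebra_simps)
    qed
    finally show "e / (1 + e) * p i x \<le> p i (x - w) + q i (y + f w) + e * p i w"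
      using e_pos by (simp add: field_simps)
  qed
  then show ?thesis using e_pos by (simp add: field_simps)
qed

lemma amalgam_graded:
  assumes "x \<in> X" "y \<in> Y"
  shows "N i (x, y) \<le> N (Suc i) (x, y)"
proof (rule amalgam_ge)
  fix w assume w: "w \<in> X"
  have "N i (x, y) \<le> p i (x - w) + q i (y + f w) + e * p i w"
    using assms w by (rule amalgam_le)
  also have "\<dots> \<le> p (Suc i) (x - w) + q (Suc i) (y + f w) + e * p (Suc i) w"
    using assms w e_pos by (intro add_mono mult_left_mono X.graded Y.graded) auto
  finally show "N i (x, y) \<le> p (Suc i) (x - w) + q (Suc i) (y + f w) + e * p (Suc i) w" .
qed

lemma amalgam_separating:
  assumes sepX: "\<And>x. x \<in> X \<Longrightarrow> (\<And>i. p i x = 0) \<Longrightarrow> x = 0"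
    and sepY: "\<And>y. y \<in> Y \<Longrightarrow> (\<And>i. q i y = 0) \<Longrightarrow> y = 0"
    and z: "x \<in> X" "y \<in> Y" "\<And>i. N i (x, y) = 0"
  shows "x = 0 \<and> y = 0"
proof -
  have "p i x = 0" for i
    using amalgam_controls_fst[OF z(1,2), of i] z(3) order.antisym[OF _ X.nonneg[OF z(1)]] by simp
  then have x: "x = 0" by (rule sepX[OF z(1)])
  have "q i y = 0" for i
    using z(3)[of i] amalgam_snd[OF z(2), of i] x by simp
  then have "y = 0" by (rule sepY[OF z(2)])
  with x show ?thesis by simp
qed

lemma amalgam_seminorms: "graded_seminorms (X \<times> Y) N"
proof
  show "subspace (X \<times> Y)" using X.subspace Y.subspace by (rule subspace_Times)
  show "seminorm_on (X \<times> Y) (N i)" for i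
    unfolding seminorm_on_def by (auto simp: amalgam_nonneg amalgam_scale amalgam_triangle)
  show "N i z \<le> N (Suc i) z" if "z \<in> X \<times> Y" for i z
    using that by (auto simp: amalgam_graded)
qed

end

section \<open>Almost inverting an almost isometry\<close>

lemma finite_dimensional_Times:
  fixes X :: "'a::real_vector set" and Y :: "'b::real_vector set"
  assumes "finite_dimensional X" "finite_dimensional Y"
  shows "finite_dimensional (X \<times> Y)"
proof -
  obtain A B where A: "finite A" "X = span A" and B: "finite B" "Y = span B"
    using assms unfolding finite_dimensional_def by blast
  let ?C = "(\<lambda>a. (a, 0)) ` A \<union> (\<lambda>b. (0, b)) ` B"
  have lin: "linear (\<lambda>a :: 'a. (a, 0 :: 'b))" "linear (\<lambda>b :: 'b. (0 :: 'a, b))"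
    by (auto intro!: linearI)
  have sub: "subspace (X \<times> Y)" using assms unfolding finite_dimensional_def by (blast intro: subspace_Times)
  have "span ?C \<subseteq> X \<times> Y"
  proof (rule span_minimal[OF _ sub])
    show "?C \<subseteq> X \<times> Y" using A B by (auto simp: span_base span_zero)
  qed
  moreover have "X \<times> Y \<subseteq> span ?C"
  proof
    fix z assume "z \<in> X \<times> Y"
    then obtain x y where z: "z = (x, y)" "x \<in> X" "y \<in> Y" by blast
    have "(x, 0 :: 'b) \<in> span ((\<lambda>a. (a, 0)) ` A)"
      unfolding linear_span_image[OF lin(1)] using z(2) A(2) by blast
    moreover have "(0 :: 'a, y) \<in> span ((\<lambda>b. (0, b)) ` B)"
      unfolding linear_span_image[OF lin(2)] using z(3) B(2) by blast
    ultimately have "(x, 0) + (0, y) \<in> span ?C"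
      by (meson span_add span_mono sup_ge1 sup_ge2 subsetD)
    then show "z \<in> span ?C" using z by simp
  qed
  ultimately show ?thesis
    using A B sub unfolding finite_dimensional_def by (metis finite_UnI finite_imageI subset_antisym)
qed

text \<open>
  Extend the inclusion of \<open>X\<close> over the amalgam of \<open>X\<close> and \<open>Y\<close>, and let \<open>g\<close> be the restriction of the
  extension to \<open>Y\<close>. Then \<open>x - g (f x)\<close> is the image of \<open>(x, - f x)\<close>, which is short in the amalgam.
\<close>

lemma almost_left_inverse:
  assumes E: "graded_frechet E p" and F: "graded_frechet F q"
    and aud: "almost_universal_disposition E p"
    and X: "finite_dimensional X" "X \<subseteq> E" and Y: "finite_dimensional Y" "Y \<subseteq> F"
    and e: "0 < e" and f: "eps_isometric_embedding e X p Y q f" and d: "0 < d"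
  shows "\<exists>g. eps_isometric_embedding d Y q E p g \<and>
             (\<forall>i. \<forall>x\<in>X. p i (g (f x) - x) \<le> (1 + d) * e * p i x)"
proof -
  interpret E: graded_frechet E p by fact
  interpret F: graded_frechet F q by fact
  have sub: "subspace X" "subspace Y" using X Y unfolding finite_dimensional_def by auto
  interpret almost_isometry X p Y q f e
    by (intro almost_isometry.intro almost_isometry_axioms.intro
        E.restrict F.restrict sub X(2) Y(2) e f)
  have XE: "x \<in> E" if "x \<in> X" for x using X(2) that by blast
  have YF: "y \<in> F" if "y \<in> Y" for y using Y(2) that by blast
  have "graded_frechet (X \<times> Y) N"
  proof (rule finite_dimensional_graded_frechet[OF amalgam_seminorms])
    show "finite_dimensional (X \<times> Y)" using X(1) Y(1) by (rule finite_dimensional_Times)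
    fix z assume "z \<in> X \<times> Y" and z0: "\<And>i. N i z = 0"
    then obtain x y where z: "z = (x, y)" "x \<in> X" "y \<in> Y" by blast
    have "x = 0 \<and> y = 0"
      by (rule amalgam_separating) (use z z0 XE YF E.separating F.separating in auto)
    then show "z = 0" using z by (simp add: zero_prod_def)
  qed
  then have "graded_frechet_space (X \<times> Y) N" by (simp add: graded_frechet_space_iff)
  moreover have "subspace (X \<times> {0 :: 'b})"
    using sub(1) by (rule subspace_Times) simp
  moreover have "X \<times> {0} \<subseteq> X \<times> Y" by auto
  moreover have "isometric_embedding (X \<times> {0}) N E p fst"
    unfolding isometric_embedding_def linear_on_def using X(2) by (auto simp: amalgam_fst)
  ultimately obtain k where k: "eps_isometric_embedding d (X \<times> Y) N E p k"
    and k_fst: "\<And>x. x \<in> X \<Longrightarrow> k (x, 0) = x"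
    using almost_universal_disposition_any_type[OF aud d _ finite_dimensional_Times[OF X(1) Y(1)],
        of N "X \<times> {0}" fst] by auto
  have kE: "k z \<in> E" and k_add: "k (z + z') = k z + k z'" and k_scale: "k (c *\<^sub>R z) = c *\<^sub>R k z"
    and k_bound: "inverse (1 + d) * N i z \<le> p i (k z)" "p i (k z) \<le> (1 + d) * N i z"
    if "z \<in> X \<times> Y" "z' \<in> X \<times> Y" for z z' c i
    using k that unfolding eps_isometric_embedding_def linear_on_def by blast+
  define g where "g y = k (0, y)" for y
  have "eps_isometric_embedding d Y q E p g"
    unfolding eps_isometric_embedding_def linear_on_def
  proof (intro conjI ballI allI)
    show "g (y + y') = g y + g y'" if "y \<in> Y" "y' \<in> Y" for y y'
      using k_add[of "(0, y)" "(0, y')"] that by (simp add: g_def)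
    show "g (c *\<^sub>R y) = c *\<^sub>R g y" if "y \<in> Y" for c y
      using k_scale[of "(0, y)" "(0, y)"] that by (simp add: g_def)
    show "g ` Y \<subseteq> E" using kE[of "(0, _)" "(0, 0)"] unfolding g_def by auto
    show "inverse (1 + d) * q i y \<le> p i (g y)" "p i (g y) \<le> (1 + d) * q i y" if "y \<in> Y" for i y
      using k_bound[of "(0, y)" "(0, y)" i] that amalgam_snd[OF that, of i] by (auto simp: g_def)
  qed
  moreover have "p i (g (f x) - x) \<le> (1 + d) * e * p i x" if x: "x \<in> X" for i x
  proof -
    have "k (x, - f x) = k ((x, 0) + (-1) *\<^sub>R (0, f x))" by simp
    also have "\<dots> = k (x, 0) + (-1) *\<^sub>R k (0, f x)"
      using k_add[of "(x, 0)" "(-1) *\<^sub>R (0, f x)"] k_scale[of "(0, f x)" "(0, f x)" "-1"] x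
      by simp
    finally have "x - g (f x) = k (x, - f x)" using k_fst[OF x] by (simp add: g_def)
    then have "p i (g (f x) - x) = p i (k (x, - f x))"
      using E.commute[of "g (f x)" x i] kE[of "(0, f x)" "(0, f x)"] XE[OF x] x by (simp add: g_def)
    also have "\<dots> \<le> (1 + d) * N i (x, - f x)" using k_bound(2)[of "(x, - f x)" "(x, - f x)"] x by simp
    also have "\<dots> \<le> (1 + d) * (e * p i x)"
      using amalgam_graph[OF x, of i] d by simp
    finally show ?thesis by (simp add: mult.assoc)
  qed
  ultimately show ?thesis by blast
qed

section \<open>One step of the back-and-forth construction\<close>

lemma linear_on_image_span:
  assumes f: "linear_on (span B) f"
  shows "f ` span B \<subseteq> span (f ` B)"
proof -
  have "x \<in> span B \<and> f x \<in> span (f ` B)" if "x \<in> span B" for x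
    using that
  proof (induction rule: span_induct_alt)
    case base
    have "f (0 *\<^sub>R 0) = 0 *\<^sub>R f 0"
      using f span_zero unfolding linear_on_def by blast
    then show ?case by (simp add: span_zero)
  next
    case (step c b x)
    then have b: "b \<in> span B" and x: "x \<in> span B" "f x \<in> span (f ` B)" by (auto intro: span_base)
    then have "f (c *\<^sub>R b + x) = c *\<^sub>R f b + f x"
      using f unfolding linear_on_def by (simp add: span_scale)
    then show ?case
      using b x step.hyps by (simp add: span_add span_scale span_base)
  qed
  then show ?thesis by blast
qed

text \<open>
  Provides the next finite-dimensional stage on either side; the image of \<open>X\<close> has to be treated by hand
  because \<open>f\<close> is linear only on \<open>X\<close>.
\<close>

lemma finite_dimensional_image_extension:
  assumes X: "finite_dimensional X" and f: "linear_on X f" "f ` X \<subseteq> F" and F: "subspace F"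
    and V: "finite_dimensional V" "V \<subseteq> F" and B: "finite B" "B \<subseteq> F"
  obtains Y where "finite_dimensional Y" "Y \<subseteq> F" "f ` X \<subseteq> Y" "V \<subseteq> Y" "B \<subseteq> Y"
proof -
  obtain A where A: "finite A" "X = span A" using X unfolding finite_dimensional_def by blast
  obtain C where C: "finite C" "V = span C" using V unfolding finite_dimensional_def by blast
  define Y where "Y = span (f ` A \<union> C \<union> B)"
  have "A \<subseteq> X" "C \<subseteq> V" using A C span_superset by auto
  then have gen: "f ` A \<union> C \<union> B \<subseteq> F"
    using f(2) V(2) B(2) by blast
  show thesis
  proof
    show "finite_dimensional Y"
      unfolding finite_dimensional_def Y_def using A(1) C(1) B(1)
      by (intro conjI exI[of _ "f ` A \<union> C \<union> B"]) auto
    show "Y \<subseteq> F" unfolding Y_def using gen F by (rule span_minimal)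
    have "f ` X \<subseteq> span (f ` A)" using linear_on_image_span f(1) A(2) by blast
    also have "\<dots> \<subseteq> Y" unfolding Y_def by (rule span_mono) blast
    finally show "f ` X \<subseteq> Y" .
    show "V \<subseteq> Y" unfolding Y_def C(2) by (rule span_mono) blast
    show "B \<subseteq> Y" unfolding Y_def using span_superset[of "f ` A \<union> C \<union> B"] by blast
  qed
qed

lemma eps_isometric_embedding_restrict_codomain:
  assumes "eps_isometric_embedding e X p F q f" "f ` X \<subseteq> Y"
  shows "eps_isometric_embedding e X p Y q f"
  using assms unfolding eps_isometric_embedding_def by blast

text \<open>
  Two almost inversions: \<open>g\<close> almost inverts \<open>f\<close> on some \<open>Y \<supseteq> f(X) \<union> B\<close>, and \<open>f'\<close> almost inverts \<open>g\<close>
  on some \<open>X' \<supseteq> g(Y) \<union> X \<union> A\<close>. A vector \<open>b \<in> B\<close> is almost attained by \<open>f'\<close> at \<open>g b\<close>, and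
  \<open>f' x - f x\<close> is estimated through \<open>f' (g (f x))\<close>. As \<open>d\<close> tends to \<open>0\<close>, the first summand
  of the bound tends to \<open>e\<close> and the second to \<open>0\<close>.
\<close>

lemma back_and_forth_step:
  assumes E: "graded_frechet E p" and F: "graded_frechet F q"
    and audE: "almost_universal_disposition E p" and audF: "almost_universal_disposition F q"
    and X: "finite_dimensional X" "X \<subseteq> E"
    and e: "0 < e" and f: "eps_isometric_embedding e X p F q f" and d: "0 < d"
    and A: "finite A" "A \<subseteq> E" and B: "finite B" "B \<subseteq> F"
  obtains X' f' where "finite_dimensional X'" "X' \<subseteq> E" "X \<subseteq> X'" "A \<subseteq> X'"
    "eps_isometric_embedding d X' p F q f'"
    "\<forall>i. \<forall>x\<in>X. q i (f' x - f x) \<le> ((1 + d)\<^sup>2 * e + (1 + d) * d * (1 + e)) * p i x"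
    "\<forall>b\<in>B. \<exists>x\<in>X'. \<forall>i. q i (f' x - b) \<le> (1 + d) * d * q i b"
proof -
  interpret E: graded_frechet E p by fact
  interpret F: graded_frechet F q by fact
  have lin: "linear_on X f" and fF: "f ` X \<subseteq> F"
    and f_upper: "\<And>i x. x \<in> X \<Longrightarrow> q i (f x) \<le> (1 + e) * p i x"
    using f unfolding eps_isometric_embedding_def by auto
  have zero: "finite_dimensional {0 :: 'b}"
    unfolding finite_dimensional_def by (auto intro!: exI[of _ "{}"] subspace_single_0)
  obtain Y where Y: "finite_dimensional Y" "Y \<subseteq> F" "f ` X \<subseteq> Y" "B \<subseteq> Y"
    by (rule finite_dimensional_image_extension[OF X(1) lin fF F.subspace zero _ B]) auto
  obtain g where g: "eps_isometric_embedding d Y q E p g"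
    and gf: "\<forall>i. \<forall>x\<in>X. p i (g (f x) - x) \<le> (1 + d) * e * p i x"
    using almost_left_inverse[OF E F audE X Y(1,2) e
        eps_isometric_embedding_restrict_codomain[OF f Y(3)] d] by (elim exE conjE)
  have g_lin: "linear_on Y g" and gE: "g ` Y \<subseteq> E"
    using g unfolding eps_isometric_embedding_def by auto
  obtain X' where X': "finite_dimensional X'" "X' \<subseteq> E" "g ` Y \<subseteq> X'" "X \<subseteq> X'" "A \<subseteq> X'"
    by (rule finite_dimensional_image_extension[OF Y(1) g_lin gE E.subspace X A])
  obtain f' where f': "eps_isometric_embedding d X' p F q f'"
    and f'g: "\<forall>i. \<forall>y\<in>Y. q i (f' (g y) - y) \<le> (1 + d) * d * q i y"
    using almost_left_inverse[OF F E audF Y(1,2) X'(1,2) d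
        eps_isometric_embedding_restrict_codomain[OF g X'(3)] d] by (elim exE conjE)
  have f'_add: "f' (x + y) = f' x + f' y" and f'_scale: "f' (c *\<^sub>R x) = c *\<^sub>R f' x"
    and f'F: "f' x \<in> F" and f'_upper: "q i (f' x) \<le> (1 + d) * p i x"
    if "x \<in> X'" "y \<in> X'" for x y c i
    using f' that unfolding eps_isometric_embedding_def linear_on_def by auto
  have subX': "subspace X'" using X'(1) unfolding finite_dimensional_def by blast
  have "q i (f' x - f x) \<le> ((1 + d)\<^sup>2 * e + (1 + d) * d * (1 + e)) * p i x" if x: "x \<in> X" for i x
  proof -
    have xX': "x \<in> X'" using x X'(4) by blast
    have fx: "f x \<in> Y" "f x \<in> F" using x fF Y(3) by auto
    have gfx: "g (f x) \<in> X'" using fx(1) X'(3) by blast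
    have diff: "f' (x - g (f x)) = f' x - f' (g (f x))"
      using f'_add[of x "-1 *\<^sub>R g (f x)"] f'_scale[of "g (f x)" "g (f x)" "-1"] xX' gfx
        subspace_scale[OF subX' gfx, of "-1"] by simp
    have xE: "x \<in> E" "g (f x) \<in> E" using xX' gfx X'(2) by auto
    have "q i (f' x - f x) \<le> q i (f' x - f' (g (f x))) + q i (f' (g (f x)) - f x)"
      using f'F[of x x] f'F[of "g (f x)" x] xX' gfx fx by (intro F.triangle3) auto
    also have "q i (f' x - f' (g (f x))) \<le> (1 + d) * p i (x - g (f x))"
      using f'_upper[of "x - g (f x)" x i] diff subspace_diff[OF subX' xX' gfx] xX' by simp
    also have "\<dots> \<le> (1 + d) * ((1 + d) * e * p i x)"
      using bspec[OF spec[OF gf] x, of i] E.commute[OF xE, of i] d by (intro mult_left_mono) auto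
    also have "q i (f' (g (f x)) - f x) \<le> (1 + d) * d * q i (f x)"
      by (rule bspec[OF spec[OF f'g] fx(1)])
    also have "\<dots> \<le> (1 + d) * d * ((1 + e) * p i x)"
      using f_upper[OF x, of i] d by (intro mult_left_mono) auto
    finally show ?thesis by (simp add: power2_eq_square algebra_simps)
  qed
  moreover have "\<exists>x\<in>X'. \<forall>i. q i (f' x - b) \<le> (1 + d) * d * q i b" if "b \<in> B" for b
  proof (intro bexI allI)
    have "b \<in> Y" using that Y(4) by blast
    then show "g b \<in> X'" "q i (f' (g b) - b) \<le> (1 + d) * d * q i b" for i
      using f'g X'(3) by auto
  qed
  ultimately show thesis by (intro that[OF X'(1,2,4,5) f'] allI ballI)
qed

section \<open>Dense sequences\<close>

lemma (in graded_frechet) separable_dense_sequence: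
  assumes "separable_space (seminorm_topology S p)"
  obtains a :: "nat \<Rightarrow> 'a" where "range a \<subseteq> S" "\<forall>x\<in>S. \<forall>i. \<forall>\<epsilon>>0. \<exists>n. p i (a n - x) < \<epsilon>"
proof -
  obtain C where C: "countable C" "C \<subseteq> S" "seminorm_topology S p closure_of C = S"
    using assms unfolding separable_space_def by auto
  have "C \<noteq> {}" using C(3) mem(1) by (metis closure_of_empty empty_iff)
  show thesis
  proof
    show "range (from_nat_into C) \<subseteq> S"
      using range_from_nat_into_subset[OF \<open>C \<noteq> {}\<close>] C(2) by simp
  next
    show "\<forall>x\<in>S. \<forall>i. \<forall>\<epsilon>>0. \<exists>n. p i (from_nat_into C n - x) < \<epsilon>"
    proof (intro ballI allI impI)
      fix x i and \<epsilon> :: real assume x: "x \<in> S" and "0 < \<epsilon>"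
      have "x \<in> seminorm_topology S p closure_of C" using C(3) x by simp
      then have "\<forall>T. x \<in> T \<and> openin (seminorm_topology S p) T \<longrightarrow> (\<exists>y. y \<in> C \<and> y \<in> T)"
        by (simp add: in_closure_of)
      note mp[OF spec[OF this] conjI]
      moreover have "x \<in> {y \<in> S. p i (y - x) < \<epsilon>}" using x \<open>0 < \<epsilon>\<close> by simp
      ultimately have "\<exists>y. y \<in> C \<and> y \<in> {y \<in> S. p i (y - x) < \<epsilon>}"
        using openin_seminorm_ball[OF x \<open>0 < \<epsilon>\<close>] .
      then obtain y where "y \<in> C" "p i (y - x) < \<epsilon>" by blast
      moreover obtain n where "from_nat_into C n = y"
        using from_nat_into_surj[OF C(1) \<open>y \<in> C\<close>] by blast
      ultimately show "\<exists>n. p i (from_nat_into C n - x) < \<epsilon>" by blast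
    qed
  qed
qed

text \<open>
  At stage \<open>k\<close> of the construction only the first terms of the dense sequence have been taken care of.
  Hence approximants are required whose indices satisfy \<open>\<nu> k \<le> k\<close>. Choosing \<open>\<nu> k\<close> optimally
  among \<open>0, \<dots>, k\<close> works, where the quality of an approximant is measured by the largest \<open>j \<le> k\<close> for
  which it is \<open>1 / (j + 1)\<close>-close in the \<open>j\<close>-th semi-norm.
\<close>

lemma (in graded_frechet) adapted_approximation:
  fixes a :: "nat \<Rightarrow> 'a"
  assumes a: "\<And>n. a n \<in> S" and dense: "\<forall>i. \<forall>\<epsilon>>0. \<exists>n. p i (a n - x) < \<epsilon>"
    and x: "x \<in> S"
  obtains \<nu> :: "nat \<Rightarrow> nat" where "\<forall>k. \<nu> k \<le> k" "seminorm_limit p (\<lambda>k. a (\<nu> k)) x"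
proof -
  define P where "P k j \<longleftrightarrow> j \<le> k \<and> (\<exists>n\<le>k. p j (a n - x) < 1 / (real j + 1))" for k j
  define \<nu> where "\<nu> k = (if \<exists>j. P k j
      then (SOME n. n \<le> k \<and> p (GREATEST j. P k j) (a n - x) < 1 / (real (GREATEST j. P k j) + 1)) else 0)"
    for k
  have key: "\<nu> k \<le> k \<and> p j (a (\<nu> k) - x) < 1 / (real j + 1)" if "P k j" for k j
  proof -
    let ?J = "GREATEST j. P k j"
    have bound: "j' \<le> k" if "P k j'" for j' using that unfolding P_def by simp
    have "P k ?J" using that bound by (rule GreatestI_nat)
    then have "\<exists>n. n \<le> k \<and> p ?J (a n - x) < 1 / (real ?J + 1)" unfolding P_def by blast
    moreover have "\<nu> k = (SOME n. n \<le> k \<and> p ?J (a n - x) < 1 / (real ?J + 1))"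
      unfolding \<nu>_def by (rule if_P) (use that in blast)
    ultimately have "\<nu> k \<le> k \<and> p ?J (a (\<nu> k) - x) < 1 / (real ?J + 1)"
      using someI_ex by simp
    moreover have "j \<le> ?J" using that bound by (rule Greatest_le_nat)
    then have "p j (a (\<nu> k) - x) \<le> p ?J (a (\<nu> k) - x)" "1 / (real ?J + 1) \<le> 1 / (real j + 1)"
      using mono a x by (auto simp: frac_le)
    ultimately show ?thesis by linarith
  qed
  show thesis
  proof
    have "\<nu> k \<le> k" for k
      using key[of k] by (cases "\<exists>j. P k j") (auto simp: \<nu>_def)
    then show "\<forall>k. \<nu> k \<le> k" by simp
    show "seminorm_limit p (\<lambda>k. a (\<nu> k)) x"
      unfolding seminorm_limit_def
    proof (intro allI LIMSEQ_I)
      fix i and r :: real assume "0 < r"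
      obtain m where m: "1 / (real m + 1) < r"
        using reals_Archimedean[OF \<open>0 < r\<close>] by (auto simp: inverse_eq_divide add.commute)
      define j where "j = max i m"
      have j: "1 / (real j + 1) \<le> 1 / (real m + 1)" unfolding j_def by (simp add: frac_le)
      obtain n where n: "p j (a n - x) < 1 / (real j + 1)" using dense by (meson zero_less_divide_1_iff of_nat_0_le_iff add_nonneg_pos zero_less_one)
      have "norm (p i (a (\<nu> k) - x) - 0) < r" if "k \<ge> max j n" for k
      proof -
        have "P k j" using that n unfolding P_def by auto
        then have "p j (a (\<nu> k) - x) < r" using key[of k j] j m by linarith
        moreover have "p i (a (\<nu> k) - x) \<le> p j (a (\<nu> k) - x)"
          unfolding j_def using a x by (intro mono) auto
        ultimately show ?thesis using a x by simp
      qed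
      then show "\<exists>no. \<forall>k\<ge>no. norm (p i (a (\<nu> k) - x) - 0) < r" by blast
    qed
  qed
qed

section \<open>The limit of a chain of almost isometries\<close>

lemma (in graded_seminorms) seminorm_CauchyI:
  assumes \<sigma>: "\<And>n. \<sigma> n \<in> S"
    and small: "\<And>i \<epsilon>. 0 < \<epsilon> \<Longrightarrow> \<exists>N. \<forall>k\<ge>N. \<forall>l\<ge>k. p i (\<sigma> l - \<sigma> k) < \<epsilon>"
  shows "seminorm_Cauchy p \<sigma>"
  unfolding seminorm_Cauchy_def
proof (intro allI impI)
  fix i and \<epsilon> :: real assume "0 < \<epsilon>"
  obtain N where N: "\<forall>k\<ge>N. \<forall>l\<ge>k. p i (\<sigma> l - \<sigma> k) < \<epsilon>"
    using small[OF \<open>0 < \<epsilon>\<close>, of i] by (elim exE)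
  have "p i (\<sigma> m - \<sigma> n) < \<epsilon>" if "m \<ge> N" "n \<ge> N" for m n
  proof (cases "m \<le> n")
    case True
    then have "p i (\<sigma> n - \<sigma> m) < \<epsilon>" using N that by simp
    then show ?thesis using commute[OF \<sigma> \<sigma>, of i m n] by simp
  qed (use N that in simp)
  then show "\<exists>N. \<forall>m\<ge>N. \<forall>n\<ge>N. p i (\<sigma> m - \<sigma> n) < \<epsilon>" by (intro exI[of _ N]) simp
qed

text \<open>
  The outcome of the construction: maps with distortions tending to zero that change little from one
  stage to the next, defined on subspaces that exhaust \<open>E\<close> up to closure and with images that exhaust
  \<open>F\<close> up to closure. Both exhaustion conditions ask for approximants taken from the stages in order.
\<close>

locale almost_isometric_chain = E: graded_frechet E p + F: graded_frechet F q
  for E :: "'a::real_vector set" and p and F :: "'b::real_vector set" and q +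
  fixes X :: "nat \<Rightarrow> 'a set" and f :: "nat \<Rightarrow> 'a \<Rightarrow> 'b" and e :: "nat \<Rightarrow> real"
  assumes X: "subspace (X n)" "X n \<subseteq> E" and X_Suc: "X n \<subseteq> X (Suc n)"
    and e_pos: "0 < e n" and e_lim: "e \<longlonglongrightarrow> 0"
    and f: "eps_isometric_embedding (e n) (X n) p F q (f n)"
    and drift_Suc: "x \<in> X n \<Longrightarrow> q i (f (Suc n) x - f n x) \<le> 2 * (e n - e (Suc n)) * p i x"
    and dense_domain: "x \<in> E \<Longrightarrow> \<exists>\<sigma>. (\<forall>k. \<sigma> k \<in> X k) \<and> seminorm_limit p \<sigma> x"
    and dense_range: "y \<in> F \<Longrightarrow> \<exists>\<sigma>. (\<forall>k. \<sigma> k \<in> X k) \<and> seminorm_limit q (\<lambda>k. f k (\<sigma> k)) y"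
begin

lemma X_E [simp]: "x \<in> X n \<Longrightarrow> x \<in> E"
  using X(2) by (rule subsetD)

lemma X_mono: "k \<le> l \<Longrightarrow> x \<in> X k \<Longrightarrow> x \<in> X l"
  using lift_Suc_mono_le[of X k l] X_Suc by auto

lemma f_F [simp]: "x \<in> X n \<Longrightarrow> f n x \<in> F"
  and f_add: "x \<in> X n \<Longrightarrow> y \<in> X n \<Longrightarrow> f n (x + y) = f n x + f n y"
  and f_scale: "x \<in> X n \<Longrightarrow> f n (c *\<^sub>R x) = c *\<^sub>R f n x"
  and f_upper: "x \<in> X n \<Longrightarrow> q i (f n x) \<le> (1 + e n) * p i x"
  using f[of n] unfolding eps_isometric_embedding_def linear_on_def by auto

lemma f_lower: "x \<in> X n \<Longrightarrow> p i x \<le> (1 + e n) * q i (f n x)"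
  using f[of n] e_pos[of n] unfolding eps_isometric_embedding_def by (simp add: field_simps)

lemma f_diff: "x \<in> X n \<Longrightarrow> y \<in> X n \<Longrightarrow> f n (x - y) = f n x - f n y"
  using f_add[of x n "-1 *\<^sub>R y"] f_scale[of y n "-1"] subspace_scale[OF X(1), of y n "-1"] by simp

lemma drift:
  assumes "k \<le> l" and x: "x \<in> X k"
  shows "q i (f l x - f k x) \<le> 2 * (e k - e l) * p i x"
  using \<open>k \<le> l\<close>
proof (induction l rule: dec_induct)
  case base
  then show ?case by simp
next
  case (step l)
  have xl: "x \<in> X l" "x \<in> X (Suc l)" using X_mono[OF _ x] step.hyps by auto
  have "q i (f (Suc l) x - f k x) \<le> q i (f (Suc l) x - f l x) + q i (f l x - f k x)"
    using xl x by (intro F.triangle3) auto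
  also have "\<dots> \<le> 2 * (e l - e (Suc l)) * p i x + 2 * (e k - e l) * p i x"
    using drift_Suc[OF xl(1)] step.IH by (rule add_mono)
  finally show ?case by (simp add: algebra_simps)
qed

lemma drift_le:
  assumes "k \<le> l" and x: "x \<in> X k"
  shows "q i (f l x - f k x) \<le> 2 * e k * p i x"
proof -
  have "2 * (e k - e l) * p i x \<le> 2 * e k * p i x"
    using e_pos[of l] x by (intro mult_right_mono) auto
  then show ?thesis using drift[OF assms, of i] by linarith
qed

lemma e_le_1: "\<exists>N. \<forall>n\<ge>N. e n \<le> 1"
proof -
  have "\<forall>\<^sub>F n in sequentially. e n < 1" using e_lim by (rule order_tendstoD) simp
  then show ?thesis by (auto simp: eventually_sequentially intro: less_imp_le)
qed

text \<open>
  Along a sequence \<open>\<sigma>\<close> with \<open>\<sigma> k \<in> X k\<close> the increments of \<open>\<sigma>\<close> and of its image under the chain control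
  each other, up to the drift between the stages \<open>k\<close> and \<open>l\<close>. Hence, if one of the two
  sequences converges, then the other is Cauchy.
\<close>

lemma increments:
  assumes \<sigma>: "\<And>k. \<sigma> k \<in> X k" and kl: "k \<le> l" and e: "e l \<le> 1"
  shows "q i (f l (\<sigma> l) - f k (\<sigma> k)) \<le> 2 * p i (\<sigma> l - \<sigma> k) + 4 * (e k * p i (\<sigma> k))"
    and "p i (\<sigma> l - \<sigma> k) \<le> 2 * q i (f l (\<sigma> l) - f k (\<sigma> k)) + 4 * (e k * p i (\<sigma> k))"
proof -
  have kX: "\<sigma> k \<in> X l" using X_mono[OF kl \<sigma>] .
  have dX: "\<sigma> l - \<sigma> k \<in> X l" using subspace_diff[OF X(1) \<sigma> kX] .
  have diff: "f l (\<sigma> l - \<sigma> k) = f l (\<sigma> l) - f l (\<sigma> k)" using f_diff[OF \<sigma> kX] .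
  have d: "q i (f l (\<sigma> k) - f k (\<sigma> k)) \<le> 2 * e k * p i (\<sigma> k)" using drift_le[OF kl \<sigma>] .
  have nn: "0 \<le> e k * p i (\<sigma> k)" using e_pos[of k] X_E[OF \<sigma>] by (intro mult_nonneg_nonneg) auto
  have mem: "f l (\<sigma> l) \<in> F" "f l (\<sigma> k) \<in> F" "f k (\<sigma> k) \<in> F" using \<sigma> kX by auto
  have "q i (f l (\<sigma> l) - f k (\<sigma> k)) \<le> q i (f l (\<sigma> l) - f l (\<sigma> k)) + q i (f l (\<sigma> k) - f k (\<sigma> k))"
    using mem by (intro F.triangle3)
  moreover have "q i (f l (\<sigma> l) - f l (\<sigma> k)) \<le> 2 * p i (\<sigma> l - \<sigma> k)"
  proof -
    have "(1 + e l) * p i (\<sigma> l - \<sigma> k) \<le> 2 * p i (\<sigma> l - \<sigma> k)"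
      using e dX by (intro mult_right_mono) auto
    then show ?thesis using f_upper[OF dX, of i] diff by simp
  qed
  ultimately show "q i (f l (\<sigma> l) - f k (\<sigma> k)) \<le> 2 * p i (\<sigma> l - \<sigma> k) + 4 * (e k * p i (\<sigma> k))"
    using d nn by simp
  have "q i (f l (\<sigma> l) - f l (\<sigma> k)) \<le> q i (f l (\<sigma> l) - f k (\<sigma> k)) + q i (f k (\<sigma> k) - f l (\<sigma> k))"
    using mem by (intro F.triangle3)
  then have "q i (f l (\<sigma> l) - f l (\<sigma> k)) \<le> q i (f l (\<sigma> l) - f k (\<sigma> k)) + 2 * (e k * p i (\<sigma> k))"
    using d F.commute[OF mem(2,3), of i] by simp
  moreover have "p i (\<sigma> l - \<sigma> k) \<le> 2 * q i (f l (\<sigma> l) - f l (\<sigma> k))"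
  proof -
    have "(1 + e l) * q i (f l (\<sigma> l - \<sigma> k)) \<le> 2 * q i (f l (\<sigma> l - \<sigma> k))"
      using e dX by (intro mult_right_mono) auto
    then show ?thesis using f_lower[OF dX, of i] diff by simp
  qed
  ultimately show "p i (\<sigma> l - \<sigma> k) \<le> 2 * q i (f l (\<sigma> l) - f k (\<sigma> k)) + 4 * (e k * p i (\<sigma> k))"
    by simp
qed

lemma transfer_smallness:
  fixes u v :: "nat \<Rightarrow> nat \<Rightarrow> real"
  assumes le: "\<And>k l. k \<le> l \<Longrightarrow> e l \<le> 1 \<Longrightarrow> u l k \<le> 2 * v l k + 4 * w k"
    and w: "w \<longlonglongrightarrow> 0" and v: "\<And>\<epsilon>. 0 < \<epsilon> \<Longrightarrow> \<exists>N. \<forall>m\<ge>N. \<forall>n\<ge>N. v m n < \<epsilon>"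
    and "0 < \<epsilon>"
  shows "\<exists>N. \<forall>k\<ge>N. \<forall>l\<ge>k. u l k < \<epsilon>"
proof -
  obtain N1 where N1: "\<forall>m\<ge>N1. \<forall>n\<ge>N1. v m n < \<epsilon> / 4" using v[of "\<epsilon> / 4"] \<open>0 < \<epsilon>\<close> by auto
  have "\<forall>\<^sub>F n in sequentially. w n < \<epsilon> / 8" using w by (rule order_tendstoD) (use \<open>0 < \<epsilon>\<close> in simp)
  then obtain N2 where N2: "\<forall>n\<ge>N2. w n < \<epsilon> / 8" unfolding eventually_sequentially by (elim exE)
  obtain N3 where N3: "\<forall>n\<ge>N3. e n \<le> 1" using e_le_1 by (elim exE)
  have "u l k < \<epsilon>" if "k \<ge> max N1 (max N2 N3)" "l \<ge> k" for k l
  proof -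
    have "v l k < \<epsilon> / 4" "w k < \<epsilon> / 8" "e l \<le> 1" using N1 N2 N3 that by auto
    then show ?thesis using le[of k l] that by simp
  qed
  then show ?thesis by (intro exI[of _ "max N1 (max N2 N3)"]) simp
qed

text \<open>
  The graph of the limit map. The relation treats the two spaces alike, so that surjectivity is proved
  like existence of the limits, and injectivity like uniqueness of the values.
\<close>

definition limit_graph :: "'a \<Rightarrow> 'b \<Rightarrow> bool" where
  "limit_graph x y \<longleftrightarrow> (\<exists>\<sigma>. (\<forall>k. \<sigma> k \<in> X k) \<and> seminorm_limit p \<sigma> x \<and>
                                seminorm_limit q (\<lambda>k. f k (\<sigma> k)) y)"

lemma limit_graph_total:
  assumes x: "x \<in> E"
  shows "\<exists>y\<in>F. limit_graph x y"
proof -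
  obtain \<sigma> where \<sigma>: "\<forall>k. \<sigma> k \<in> X k" and lim: "seminorm_limit p \<sigma> x"
    using dense_domain[OF x] by (elim exE conjE)
  have \<sigma>X: "\<sigma> k \<in> X k" and \<sigma>E: "\<sigma> k \<in> E" for k using \<sigma> X_E[of "\<sigma> k" k] by auto
  have "seminorm_Cauchy p \<sigma>" using \<sigma>E x lim by (rule E.seminorm_limit_imp_Cauchy)
  have "seminorm_Cauchy q (\<lambda>k. f k (\<sigma> k))"
  proof (rule F.seminorm_CauchyI)
    show "f k (\<sigma> k) \<in> F" for k using \<sigma>X by simp
    fix i and \<epsilon> :: real assume "0 < \<epsilon>"
    show "\<exists>N. \<forall>k\<ge>N. \<forall>l\<ge>k. q i (f l (\<sigma> l) - f k (\<sigma> k)) < \<epsilon>"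
    proof (rule transfer_smallness[OF increments(1)[OF \<sigma>X] _ _ \<open>0 < \<epsilon>\<close>])
      show "(\<lambda>k. e k * p i (\<sigma> k)) \<longlonglongrightarrow> 0"
        using tendsto_mult[OF e_lim E.seminorm_limit_value[OF \<sigma>E x lim, of i]] by simp
      show "\<exists>N. \<forall>m\<ge>N. \<forall>n\<ge>N. p i (\<sigma> m - \<sigma> n) < \<delta>" if "0 < \<delta>" for \<delta>
        using \<open>seminorm_Cauchy p \<sigma>\<close> that unfolding seminorm_Cauchy_def by simp
    qed
  qed
  then obtain y where "y \<in> F" "seminorm_limit q (\<lambda>k. f k (\<sigma> k)) y"
    using F.complete[of "\<lambda>k. f k (\<sigma> k)"] \<sigma>X by auto
  then show ?thesis unfolding limit_graph_def using \<sigma> lim by auto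
qed

lemma limit_graph_onto:
  assumes y: "y \<in> F"
  shows "\<exists>x\<in>E. limit_graph x y"
proof -
  obtain \<sigma> where \<sigma>: "\<forall>k. \<sigma> k \<in> X k" and lim: "seminorm_limit q (\<lambda>k. f k (\<sigma> k)) y"
    using dense_range[OF y] by (elim exE conjE)
  have \<sigma>X: "\<sigma> k \<in> X k" and \<sigma>E: "\<sigma> k \<in> E" and fF: "f k (\<sigma> k) \<in> F" for k
    using \<sigma> X_E[of "\<sigma> k" k] by auto
  have "seminorm_Cauchy q (\<lambda>k. f k (\<sigma> k))" using fF y lim by (rule F.seminorm_limit_imp_Cauchy)
  have "seminorm_Cauchy p \<sigma>"
  proof (rule E.seminorm_CauchyI[OF \<sigma>E])
    fix i and \<epsilon> :: real assume "0 < \<epsilon>"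
    show "\<exists>N. \<forall>k\<ge>N. \<forall>l\<ge>k. p i (\<sigma> l - \<sigma> k) < \<epsilon>"
    proof (rule transfer_smallness[OF increments(2)[OF \<sigma>X] _ _ \<open>0 < \<epsilon>\<close>])
      show "(\<lambda>k. e k * p i (\<sigma> k)) \<longlonglongrightarrow> 0"
      proof (rule Lim_null_comparison)
        have "norm (e k * p i (\<sigma> k)) \<le> e k * ((1 + e k) * q i (f k (\<sigma> k)))" for k
          using f_lower[OF \<sigma>X, of i k] e_pos[of k] \<sigma>E[of k] by (simp add: abs_mult)
        then show "\<forall>\<^sub>F k in sequentially. norm (e k * p i (\<sigma> k)) \<le> e k * ((1 + e k) * q i (f k (\<sigma> k)))"
          by simp
        have "(\<lambda>k. e k * ((1 + e k) * q i (f k (\<sigma> k)))) \<longlonglongrightarrow> 0 * ((1 + 0) * q i y)"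
          by (intro tendsto_intros e_lim F.seminorm_limit_value[OF fF y lim])
        then show "(\<lambda>k. e k * ((1 + e k) * q i (f k (\<sigma> k)))) \<longlonglongrightarrow> 0" by simp
      qed
      show "\<exists>N. \<forall>m\<ge>N. \<forall>n\<ge>N. q i (f m (\<sigma> m) - f n (\<sigma> n)) < \<delta>" if "0 < \<delta>" for \<delta>
        using \<open>seminorm_Cauchy q _\<close> that unfolding seminorm_Cauchy_def by simp
    qed
  qed
  then obtain x where "x \<in> E" "seminorm_limit p \<sigma> x"
    using E.complete[of \<sigma>, OF \<sigma>E] by auto
  then show ?thesis unfolding limit_graph_def using \<sigma> lim by auto
qed

lemma limit_graph_add:
  assumes "x \<in> E" "y \<in> F" "x' \<in> E" "y' \<in> F" "limit_graph x y" "limit_graph x' y'"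
  shows "limit_graph (x + x') (y + y')"
proof -
  obtain \<sigma> \<tau> where \<sigma>: "\<And>k. \<sigma> k \<in> X k" "seminorm_limit p \<sigma> x" "seminorm_limit q (\<lambda>k. f k (\<sigma> k)) y"
    and \<tau>: "\<And>k. \<tau> k \<in> X k" "seminorm_limit p \<tau> x'" "seminorm_limit q (\<lambda>k. f k (\<tau> k)) y'"
    using assms(5,6) unfolding limit_graph_def by auto
  have "seminorm_limit p (\<lambda>k. \<sigma> k + \<tau> k) (x + x')"
    by (rule E.seminorm_limit_add[OF X_E[OF \<sigma>(1)] X_E[OF \<tau>(1)] assms(1,3) \<sigma>(2) \<tau>(2)])
  moreover have "seminorm_limit q (\<lambda>k. f k (\<sigma> k) + f k (\<tau> k)) (y + y')"
    by (rule F.seminorm_limit_add[OF f_F[OF \<sigma>(1)] f_F[OF \<tau>(1)] assms(2,4) \<sigma>(3) \<tau>(3)])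
  ultimately show ?thesis
    unfolding limit_graph_def
    by (intro exI[of _ "\<lambda>k. \<sigma> k + \<tau> k"]) (simp add: f_add \<sigma>(1) \<tau>(1) subspace_add[OF X(1)])
qed

lemma limit_graph_scale:
  assumes "x \<in> E" "y \<in> F" "limit_graph x y"
  shows "limit_graph (c *\<^sub>R x) (c *\<^sub>R y)"
proof -
  obtain \<sigma> where \<sigma>: "\<And>k. \<sigma> k \<in> X k" "seminorm_limit p \<sigma> x" "seminorm_limit q (\<lambda>k. f k (\<sigma> k)) y"
    using assms(3) unfolding limit_graph_def by auto
  have "seminorm_limit p (\<lambda>k. c *\<^sub>R \<sigma> k) (c *\<^sub>R x)"
    by (rule E.seminorm_limit_scale[OF X_E[OF \<sigma>(1)] assms(1) \<sigma>(2)])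
  moreover have "seminorm_limit q (\<lambda>k. c *\<^sub>R f k (\<sigma> k)) (c *\<^sub>R y)"
    by (rule F.seminorm_limit_scale[OF f_F[OF \<sigma>(1)] assms(2) \<sigma>(3)])
  ultimately show ?thesis
    unfolding limit_graph_def
    by (intro exI[of _ "\<lambda>k. c *\<^sub>R \<sigma> k"]) (simp add: f_scale \<sigma>(1) subspace_scale[OF X(1)])
qed

lemma limit_graph_isometric:
  assumes "x \<in> E" "y \<in> F" "limit_graph x y"
  shows "q i y = p i x"
proof -
  obtain \<sigma> where \<sigma>: "\<And>k. \<sigma> k \<in> X k" "seminorm_limit p \<sigma> x" "seminorm_limit q (\<lambda>k. f k (\<sigma> k)) y"
    using assms(3) unfolding limit_graph_def by auto
  have lim_p: "(\<lambda>k. p i (\<sigma> k)) \<longlonglongrightarrow> p i x"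
    by (rule E.seminorm_limit_value[OF X_E[OF \<sigma>(1)] assms(1) \<sigma>(2)])
  have lim_q: "(\<lambda>k. q i (f k (\<sigma> k))) \<longlonglongrightarrow> q i y"
    by (rule F.seminorm_limit_value[OF f_F[OF \<sigma>(1)] assms(2) \<sigma>(3)])
  have "q i y \<le> (1 + 0) * p i x"
  proof (rule LIMSEQ_le[OF lim_q])
    show "(\<lambda>k. (1 + e k) * p i (\<sigma> k)) \<longlonglongrightarrow> (1 + 0) * p i x"
      by (intro tendsto_intros e_lim lim_p)
    show "\<exists>N. \<forall>n\<ge>N. q i (f n (\<sigma> n)) \<le> (1 + e n) * p i (\<sigma> n)"
      using f_upper[OF \<sigma>(1)] by simp
  qed
  moreover have "p i x \<le> (1 + 0) * q i y"
  proof (rule LIMSEQ_le[OF lim_p])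
    show "(\<lambda>k. (1 + e k) * q i (f k (\<sigma> k))) \<longlonglongrightarrow> (1 + 0) * q i y"
      by (intro tendsto_intros e_lim lim_q)
    show "\<exists>N. \<forall>n\<ge>N. p i (\<sigma> n) \<le> (1 + e n) * q i (f n (\<sigma> n))"
      using f_lower[OF \<sigma>(1)] by simp
  qed
  ultimately show ?thesis by simp
qed

lemma limit_graph_diff:
  assumes "x \<in> E" "y \<in> F" "x' \<in> E" "y' \<in> F" "limit_graph x y" "limit_graph x' y'"
  shows "limit_graph (x - x') (y - y')"
  using limit_graph_add[OF assms(1,2) _ _ assms(5) limit_graph_scale[OF assms(3,4,6), of "-1"]] assms(3,4)
  by simp

lemma limit_graph_unique:
  assumes "x \<in> E" "y \<in> F" "x' \<in> E" "y' \<in> F" "limit_graph x y" "limit_graph x' y'"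
  shows "x = x' \<longleftrightarrow> y = y'"
proof -
  have iso: "q i (y - y') = p i (x - x')" for i
    by (rule limit_graph_isometric[OF _ _ limit_graph_diff[OF assms]]) (use assms in simp_all)
  show ?thesis
  proof
    assume "x = x'"
    then have "q i (y - y') = 0" for i using iso by simp
    then have "y - y' = 0" using assms by (intro F.separating) auto
    then show "y = y'" by simp
  next
    assume "y = y'"
    then have "p i (x - x') = 0" for i using iso[of i] by simp
    then have "x - x' = 0" using assms by (intro E.separating) auto
    then show "x = x'" by simp
  qed
qed

text \<open>
  For \<open>x\<close> in the first subspace the value of the limit map is \<open>lim f k x\<close>, whatever sequence
  witnesses it, and the drifts from stage \<open>0\<close> on add up to at most \<open>2 * e 0 * p i x\<close>.
\<close>

lemma limit_graph_near_start:
  assumes x: "x \<in> X 0" and y: "y \<in> F" "limit_graph x y"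
  shows "q i (y - f 0 x) \<le> 2 * e 0 * p i x"
proof -
  obtain \<sigma> where \<sigma>: "\<And>k. \<sigma> k \<in> X k" "seminorm_limit p \<sigma> x" "seminorm_limit q (\<lambda>k. f k (\<sigma> k)) y"
    using y(2) unfolding limit_graph_def by auto
  have xk: "x \<in> X k" for k using X_mono[OF _ x, of k] by simp
  have bound: "q i (y - f 0 x) \<le> q i (f k (\<sigma> k) - y) + (1 + e k) * p i (\<sigma> k - x) + 2 * e 0 * p i x" for k
  proof -
    have mem: "f k (\<sigma> k) \<in> F" "f k x \<in> F" "f 0 x \<in> F" using \<sigma>(1) xk x by auto
    have "q i (y - f 0 x) \<le> q i (y - f k (\<sigma> k)) + q i (f k (\<sigma> k) - f 0 x)"
      using y(1) mem(1,3) by (rule F.triangle3)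
    moreover have "q i (f k (\<sigma> k) - f 0 x) \<le> q i (f k (\<sigma> k) - f k x) + q i (f k x - f 0 x)"
      using mem by (rule F.triangle3)
    moreover have "q i (f k (\<sigma> k) - f k x) \<le> (1 + e k) * p i (\<sigma> k - x)"
      using f_upper[OF subspace_diff[OF X(1) \<sigma>(1) xk], of i] f_diff[OF \<sigma>(1) xk] by simp
    moreover have "q i (f k x - f 0 x) \<le> 2 * e 0 * p i x" using x by (intro drift_le) auto
    ultimately show ?thesis using F.commute[OF y(1) mem(1), of i] by linarith
  qed
  have "(\<lambda>k. q i (f k (\<sigma> k) - y)) \<longlonglongrightarrow> 0" "(\<lambda>k. p i (\<sigma> k - x)) \<longlonglongrightarrow> 0"
    using \<sigma>(2,3) unfolding seminorm_limit_def by auto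
  then have "(\<lambda>k. q i (f k (\<sigma> k) - y) + (1 + e k) * p i (\<sigma> k - x) + 2 * e 0 * p i x)
      \<longlonglongrightarrow> 0 + (1 + 0) * 0 + 2 * e 0 * p i x"
    by (intro tendsto_intros e_lim)
  then have "q i (y - f 0 x) \<le> 0 + (1 + 0) * 0 + 2 * e 0 * p i x"
    by (rule LIMSEQ_le_const) (use bound in simp)
  then show ?thesis by simp
qed

lemma limit_isometry:
  "\<exists>h. bijective_isometry E p F q h \<and> (\<forall>i. \<forall>x\<in>X 0. q i (h x - f 0 x) \<le> 2 * e 0 * p i x)"
proof -
  define h where "h x = (SOME y. y \<in> F \<and> limit_graph x y)" for x
  have h: "h x \<in> F" "limit_graph x (h x)" if "x \<in> E" for x
    using someI_ex[of "\<lambda>y. y \<in> F \<and> limit_graph x y"] limit_graph_total[OF that]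
    unfolding h_def by auto
  have h_eqI: "h x = y" if "x \<in> E" "y \<in> F" "limit_graph x y" for x y
    using limit_graph_unique[OF that(1) h(1) that(1,2) h(2) that(3)] that(1) by simp
  have "linear_on E h"
    unfolding linear_on_def
    by (intro conjI ballI allI h_eqI limit_graph_add limit_graph_scale) (simp_all add: h)
  moreover have "h ` E \<subseteq> F" using h(1) by (rule image_subsetI)
  moreover have "q i (h x) = p i x" if "x \<in> E" for i x
    by (rule limit_graph_isometric[OF that h[OF that]])
  moreover have "bij_betw h E F"
    unfolding bij_betw_def
  proof
    show "inj_on h E"
    proof (rule inj_onI)
      fix x x' assume x: "x \<in> E" "x' \<in> E" "h x = h x'"
      show "x = x'"
        using limit_graph_unique[OF x(1) h(1)[OF x(1)] x(2) h(1)[OF x(2)] h(2)[OF x(1)] h(2)[OF x(2)]] x(3)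
        by simp
    qed
    show "h ` E = F"
    proof (rule equalityI[OF \<open>h ` E \<subseteq> F\<close> subsetI])
      fix y assume y: "y \<in> F"
      obtain x where "x \<in> E" "limit_graph x y" using limit_graph_onto[OF y] by (elim bexE)
      then show "y \<in> h ` E" using h_eqI[of x y] y by auto
    qed
  qed
  ultimately have "bijective_isometry E p F q h"
    unfolding bijective_isometry_def isometric_embedding_def by simp
  moreover have "q i (h x - f 0 x) \<le> 2 * e 0 * p i x" if "x \<in> X 0" for i x
    by (rule limit_graph_near_start[OF that h[OF X_E[OF that]]])
  ultimately show ?thesis by (intro exI[of _ h]) simp
qed

end

section \<open>Running the back-and-forth construction\<close>

text \<open>
  The bound of \<open>back_and_forth_step\<close> fits under a telescoping one when the distortions decrease
  geometrically with a small ratio. The condition on \<open>\<rho> * \<epsilon>\<close> absorbs the factor \<open>1 + e\<close>, as \<open>\<epsilon>\<close> may be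
  large; with it the left-hand side is at most \<open>99 / 64 * e\<close>, the right-hand side at least \<open>7 / 4 * e\<close>.
\<close>

lemma geometric_drift_bound:
  fixes e d \<epsilon> \<rho> :: real
  assumes "0 < e" "e \<le> \<epsilon>" "d = \<rho> * e" "0 < \<rho>" "\<rho> \<le> 1 / 8" "\<rho> * \<epsilon> \<le> 1 / 8"
  shows "(1 + d)\<^sup>2 * e + (1 + d) * d * (1 + e) \<le> 2 * (e - d)"
proof -
  have d0: "0 < d" using assms by simp
  have "\<rho> * e \<le> \<rho> * \<epsilon>" using assms by simp
  then have d8: "d \<le> 1 / 8" using assms(3,6) by linarith
  have de8: "d \<le> e / 8" using mult_right_mono[of \<rho> "1 / 8" e] assms by simp
  have "d * e \<le> e / 8" using mult_right_mono[OF d8, of e] assms by simp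
  then have "d * (1 + e) \<le> e / 4" using de8 by (simp add: distrib_left)
  then have "(1 + d) * (d * (1 + e)) \<le> 9 / 8 * (e / 4)"
    using d0 d8 assms(1) by (intro mult_mono) auto
  then have "(1 + d) * d * (1 + e) \<le> 9 / 32 * e" by (simp add: mult.assoc)
  moreover have "(1 + d)\<^sup>2 \<le> (9 / 8)\<^sup>2" using d0 d8 by (intro power_mono) auto
  then have "(1 + d)\<^sup>2 * e \<le> (9 / 8)\<^sup>2 * e" using assms(1) by (intro mult_right_mono) auto
  then have "(1 + d)\<^sup>2 * e \<le> 81 / 64 * e" by (simp add: power2_eq_square)
  moreover have "u + v \<le> 2 * (e - d)" if "v \<le> 9 / 32 * e" "u \<le> 81 / 64 * e" for u v
    using that de8 assms(1) by (simp add: field_simps)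
  ultimately show ?thesis by blast
qed

text \<open>
  Stage \<open>n + 1\<close> of the chain takes care of the first \<open>n + 1\<close> terms of a dense sequence on each side,
  which is what adapted approximations need.
\<close>

lemma bijective_isometry_near_almost_isometry:
  fixes E :: "'a::real_vector set" and F :: "'b::real_vector set"
  assumes E: "graded_frechet E p" and F: "graded_frechet F q"
    and sepE: "separable_space (seminorm_topology E p)"
    and sepF: "separable_space (seminorm_topology F q)"
    and audE: "almost_universal_disposition E p" and audF: "almost_universal_disposition F q"
    and \<epsilon>: "0 < \<epsilon>" and X: "finite_dimensional X" "X \<subseteq> E"
    and f: "eps_isometric_embedding \<epsilon> X p F q f"
  shows "\<exists>h. bijective_isometry E p F q h \<and> (\<forall>i. \<forall>x\<in>X. q i (h x - f x) \<le> 2 * \<epsilon> * p i x)"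
proof -
  interpret E: graded_frechet E p by fact
  interpret F: graded_frechet F q by fact
  obtain a :: "nat \<Rightarrow> 'a" where aE: "range a \<subseteq> E"
    and a_dense: "\<forall>x\<in>E. \<forall>i. \<forall>\<delta>>0. \<exists>n. p i (a n - x) < \<delta>"
    by (rule E.separable_dense_sequence[OF sepE])
  obtain b :: "nat \<Rightarrow> 'b" where bF: "range b \<subseteq> F"
    and b_dense: "\<forall>y\<in>F. \<forall>i. \<forall>\<delta>>0. \<exists>n. q i (b n - y) < \<delta>"
    by (rule F.separable_dense_sequence[OF sepF])
  have a: "a n \<in> E" and b: "b n \<in> F" for n using aE bF by auto
  define \<rho> where "\<rho> = 1 / (8 * max 1 \<epsilon>)"
  have \<rho>: "0 < \<rho>" "\<rho> \<le> 1 / 8" "\<rho> * \<epsilon> \<le> 1 / 8" unfolding \<rho>_def by (auto simp: field_simps)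
  define e where "e n = \<epsilon> * \<rho> ^ n" for n
  have e_pos: "0 < e n" for n using \<epsilon> \<rho>(1) by (simp add: e_def)
  have e_le: "e n \<le> \<epsilon>" for n
    using \<epsilon> \<rho> power_le_one[of \<rho> n] unfolding e_def by (simp add: mult_left_le)
  have e_Suc: "e (Suc n) = \<rho> * e n" for n by (simp add: e_def)
  have "(\<lambda>n. \<rho> ^ n) \<longlonglongrightarrow> 0" using \<rho> by (intro LIMSEQ_realpow_zero) auto
  then have e_lim: "e \<longlonglongrightarrow> 0"
    using tendsto_mult[OF tendsto_const[of \<epsilon>]] unfolding e_def by fastforce
  define P where "P n s \<longleftrightarrow> finite_dimensional (fst s) \<and> fst s \<subseteq> E \<and>
      eps_isometric_embedding (e n) (fst s) p F q (snd s) \<and> (n = 0 \<longrightarrow> s = (X, f))" for n s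
  define Q where "Q n s t \<longleftrightarrow> fst s \<subseteq> fst t \<and> a ` {..n} \<subseteq> fst t \<and>
      (\<forall>i. \<forall>x\<in>fst s. q i (snd t x - snd s x) \<le> 2 * (e n - e (Suc n)) * p i x) \<and>
      (\<forall>y\<in>b ` {..n}. \<exists>x\<in>fst t. \<forall>i. q i (snd t x - y) \<le> (1 + e (Suc n)) * e (Suc n) * q i y)"
    for n and s t :: "'a set \<times> ('a \<Rightarrow> 'b)"
  have "\<exists>t. P (Suc n) t \<and> Q n s t" if s: "P n s" for n s
  proof -
    obtain V g where s_eq: "s = (V, g)" by (rule prod.exhaust)
    have V: "finite_dimensional V" "V \<subseteq> E" and g: "eps_isometric_embedding (e n) V p F q g"
      using s unfolding P_def s_eq by auto
    have A: "finite (a ` {..n})" "a ` {..n} \<subseteq> E" and B: "finite (b ` {..n})" "b ` {..n} \<subseteq> F"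
      using a b by auto
    obtain V' g' where V': "finite_dimensional V'" "V' \<subseteq> E" "V \<subseteq> V'" "a ` {..n} \<subseteq> V'"
      and g': "eps_isometric_embedding (e (Suc n)) V' p F q g'"
      and close: "\<forall>i. \<forall>x\<in>V. q i (g' x - g x) \<le>
        ((1 + e (Suc n))\<^sup>2 * e n + (1 + e (Suc n)) * e (Suc n) * (1 + e n)) * p i x"
      and hit: "\<forall>y\<in>b ` {..n}.
        \<exists>x\<in>V'. \<forall>i. q i (g' x - y) \<le> (1 + e (Suc n)) * e (Suc n) * q i y"
      by (rule back_and_forth_step[OF E F audE audF V e_pos g e_pos A B])
    have "q i (g' x - g x) \<le> 2 * (e n - e (Suc n)) * p i x" if x: "x \<in> V" for i x
    proof -
      have "(1 + e (Suc n))\<^sup>2 * e n + (1 + e (Suc n)) * e (Suc n) * (1 + e n) \<le> 2 * (e n - e (Suc n))"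
        by (rule geometric_drift_bound[OF e_pos e_le e_Suc \<rho>])
      then show ?thesis
        using bspec[OF spec[OF close] x, of i] mult_right_mono[OF _ E.nonneg[OF subsetD[OF V(2) x], of i]]
        by (meson order_trans)
    qed
    then show ?thesis
      unfolding P_def Q_def s_eq using V' g' hit by (intro exI[of _ "(V', g')"]) simp
  qed
  moreover have "P 0 (X, f)" unfolding P_def using X f by (simp add: e_def)
  ultimately obtain s where P: "\<And>n. P n (s n)" and Q: "\<And>n. Q n (s n) (s (Suc n))"
    using dependent_nat_choice[of P Q] by metis
  define V where "V n = fst (s n)" for n
  define g where "g n = snd (s n)" for n
  have V: "finite_dimensional (V n)" "V n \<subseteq> E"
    and g: "eps_isometric_embedding (e n) (V n) p F q (g n)" for n
    using P[of n] unfolding P_def V_def g_def by auto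
  have start: "V 0 = X" "g 0 = f" using P[of 0] unfolding P_def V_def g_def by auto
  have sub: "subspace (V n)" for n using V(1)[of n] unfolding finite_dimensional_def by simp
  have zero: "0 \<in> V n" for n using sub by (rule subspace_0)
  have V_Suc: "V n \<subseteq> V (Suc n)" and a_V: "a ` {..n} \<subseteq> V (Suc n)"
    and drift: "\<forall>i. \<forall>x\<in>V n. q i (g (Suc n) x - g n x) \<le> 2 * (e n - e (Suc n)) * p i x"
    and hit: "\<forall>y\<in>b ` {..n}. \<exists>x\<in>V (Suc n). \<forall>i. q i (g (Suc n) x - y) \<le>
        (1 + e (Suc n)) * e (Suc n) * q i y" for n
    using Q[of n] unfolding Q_def V_def g_def by simp_all
  interpret almost_isometric_chain E p F q V g e
  proof
    show "subspace (V n)" "V n \<subseteq> E" "V n \<subseteq> V (Suc n)" "0 < e n"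
      "eps_isometric_embedding (e n) (V n) p F q (g n)" for n
      using sub V(2) V_Suc e_pos g by auto
    show "e \<longlonglongrightarrow> 0" by (rule e_lim)
    show "q i (g (Suc n) x - g n x) \<le> 2 * (e n - e (Suc n)) * p i x" if "x \<in> V n" for n i x
      using drift that by simp
  next
    fix x assume x: "x \<in> E"
    obtain \<nu> where \<nu>: "\<forall>k. \<nu> k \<le> k" "seminorm_limit p (\<lambda>k. a (\<nu> k)) x"
      by (rule E.adapted_approximation[OF a bspec[OF a_dense x] x])
    \<comment> \<open>\<open>a k\<close> is available only from stage \<open>Suc k\<close> on, hence the shift\<close>
    define \<sigma> where "\<sigma> = case_nat 0 (\<lambda>k. a (\<nu> k))"
    have "\<sigma> k \<in> V k" for k
    proof (cases k)
      case (Suc m)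
      have "a (\<nu> m) \<in> a ` {..m}" using \<nu>(1) by simp
      then show ?thesis using a_V[of m] Suc by (auto simp: \<sigma>_def)
    qed (simp add: \<sigma>_def zero)
    moreover have "seminorm_limit p \<sigma> x"
      unfolding seminorm_limit_def
    proof
      fix i
      have "(\<lambda>k. p i (\<sigma> (Suc k) - x)) \<longlonglongrightarrow> 0"
        using \<nu>(2) unfolding seminorm_limit_def by (simp add: \<sigma>_def)
      then show "(\<lambda>k. p i (\<sigma> k - x)) \<longlonglongrightarrow> 0"
        using filterlim_sequentially_Suc[of "\<lambda>k. p i (\<sigma> k - x)"] by simp
    qed
    ultimately show "\<exists>\<sigma>. (\<forall>k. \<sigma> k \<in> V k) \<and> seminorm_limit p \<sigma> x" by (intro exI[of _ \<sigma>]) simp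
  next
    fix y assume y: "y \<in> F"
    obtain \<nu> where \<nu>: "\<forall>k. \<nu> k \<le> k" and lim: "seminorm_limit q (\<lambda>k. b (\<nu> k)) y"
      by (rule F.adapted_approximation[OF b bspec[OF b_dense y] y])
    have "\<forall>k. \<exists>x. x \<in> V (Suc k) \<and>
        (\<forall>i. q i (g (Suc k) x - b (\<nu> k)) \<le> (1 + e (Suc k)) * e (Suc k) * q i (b (\<nu> k)))"
    proof
      fix k
      have "b (\<nu> k) \<in> b ` {..k}" using \<nu> by simp
      from bspec[OF hit this] show "\<exists>x. x \<in> V (Suc k) \<and>
        (\<forall>i. q i (g (Suc k) x - b (\<nu> k)) \<le> (1 + e (Suc k)) * e (Suc k) * q i (b (\<nu> k)))"
        by (simp add: Bex_def)
    qed
    then obtain \<tau> where \<tau>: "\<forall>k. \<tau> k \<in> V (Suc k) \<and>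
        (\<forall>i. q i (g (Suc k) (\<tau> k) - b (\<nu> k)) \<le> (1 + e (Suc k)) * e (Suc k) * q i (b (\<nu> k)))"
      by (rule choice[THEN exE])
    define \<sigma> where "\<sigma> = case_nat 0 \<tau>"
    have \<sigma>V: "\<sigma> k \<in> V k" for k
      using \<tau> zero by (cases k) (simp_all add: \<sigma>_def)
    have gF: "g k (\<sigma> k) \<in> F" for k
      using g[of k] \<sigma>V[of k] unfolding eps_isometric_embedding_def by auto
    have "seminorm_limit q (\<lambda>k. g k (\<sigma> k)) y"
      unfolding seminorm_limit_def
    proof
      fix i
      have e_lim': "(\<lambda>k. e (Suc k)) \<longlonglongrightarrow> 0" using e_lim by (rule LIMSEQ_Suc)
      have "(\<lambda>k. q i (g (Suc k) (\<sigma> (Suc k)) - y)) \<longlonglongrightarrow> 0"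
      proof (rule Lim_null_comparison)
        have "norm (q i (g (Suc k) (\<sigma> (Suc k)) - y)) \<le>
            (1 + e (Suc k)) * e (Suc k) * q i (b (\<nu> k)) + q i (b (\<nu> k) - y)" for k
        proof -
          have "q i (g (Suc k) (\<sigma> (Suc k)) - y) \<le>
              q i (g (Suc k) (\<sigma> (Suc k)) - b (\<nu> k)) + q i (b (\<nu> k) - y)"
            by (rule F.triangle3[OF gF b y])
          moreover have "q i (g (Suc k) (\<sigma> (Suc k)) - b (\<nu> k)) \<le>
              (1 + e (Suc k)) * e (Suc k) * q i (b (\<nu> k))"
            using \<tau> by (simp add: \<sigma>_def)
          ultimately show ?thesis using gF[of "Suc k"] y by simp
        qed
        then show "\<forall>\<^sub>F k in sequentially. norm (q i (g (Suc k) (\<sigma> (Suc k)) - y)) \<le>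
            (1 + e (Suc k)) * e (Suc k) * q i (b (\<nu> k)) + q i (b (\<nu> k) - y)" by simp
        have "(\<lambda>k. q i (b (\<nu> k) - y)) \<longlonglongrightarrow> 0" using lim unfolding seminorm_limit_def by simp
        then have "(\<lambda>k. (1 + e (Suc k)) * e (Suc k) * q i (b (\<nu> k)) + q i (b (\<nu> k) - y))
            \<longlonglongrightarrow> (1 + 0) * 0 * q i y + 0"
          by (intro tendsto_intros e_lim' F.seminorm_limit_value[OF b y lim])
        then show "(\<lambda>k. (1 + e (Suc k)) * e (Suc k) * q i (b (\<nu> k)) + q i (b (\<nu> k) - y)) \<longlonglongrightarrow> 0"
          by simp
      qed
      then show "(\<lambda>k. q i (g k (\<sigma> k) - y)) \<longlonglongrightarrow> 0"
        using filterlim_sequentially_Suc[of "\<lambda>k. q i (g k (\<sigma> k) - y)"] by simp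
    qed
    then show "\<exists>\<sigma>. (\<forall>k. \<sigma> k \<in> V k) \<and> seminorm_limit q (\<lambda>k. g k (\<sigma> k)) y"
      using \<sigma>V by (intro exI[of _ \<sigma>]) simp
  qed
  show ?thesis using limit_isometry start by (simp add: e_def)
qed

theorem proposition4p1:
  fixes E :: "'a::real_vector set" and p :: "nat \<Rightarrow> 'a \<Rightarrow> real"
    and F :: "'b::real_vector set" and q :: "nat \<Rightarrow> 'b \<Rightarrow> real"
    and \<epsilon> :: real and X :: "'a set" and f :: "'a \<Rightarrow> 'b"
  assumes "graded_frechet_space E p" and "graded_frechet_space F q"
    and "separable_space (seminorm_topology E p)" and "separable_space (seminorm_topology F q)"
    and "almost_universal_disposition E p" and "almost_universal_disposition F q"
    and "\<epsilon> > 0"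
    and "finite_dimensional X" and "X \<subseteq> E"
    and "eps_isometric_embedding \<epsilon> X p F q f"
  shows "\<exists>h. bijective_isometry E p F q h \<and>
           (\<forall>i. \<forall>x\<in>X. q i (h x - f x) \<le> 4 * \<epsilon> * p i x \<and>
                      (p i x \<noteq> 0 \<longrightarrow> q i (h x - f x) < 4 * \<epsilon> * p i x))"
proof -
  have E: "graded_frechet E p" and F: "graded_frechet F q"
    using assms(1,2) by (simp_all add: graded_frechet_space_iff)
  interpret E: graded_frechet E p by fact
  obtain h where h: "bijective_isometry E p F q h"
    and close: "\<forall>i. \<forall>x\<in>X. q i (h x - f x) \<le> 2 * \<epsilon> * p i x"
    using bijective_isometry_near_almost_isometry[OF E F assms(3-10)] by (elim exE conjE)
  have "q i (h x - f x) \<le> 4 * \<epsilon> * p i x \<and> (p i x \<noteq> 0 \<longrightarrow> q i (h x - f x) < 4 * \<epsilon> * p i x)"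
    if x: "x \<in> X" for i x
  proof -
    have nn: "0 \<le> p i x" using E.nonneg[OF subsetD[OF assms(9) x]] .
    have "q i (h x - f x) \<le> 2 * (\<epsilon> * p i x)" using close x by (simp add: mult.assoc)
    moreover have "0 \<le> \<epsilon> * p i x" using nn assms(7) by simp
    moreover have "0 < \<epsilon> * p i x" if "p i x \<noteq> 0" using nn that assms(7) by simp
    ultimately show ?thesis by (cases "p i x = 0") (auto simp: mult.assoc)
  qed
  then show ?thesis using h by (intro exI[of _ h]) simp
qed

end
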